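(* Let $g\ge 1$ and $k\ge 1$ be integers and let $f\in M_{2k}(\Gamma_g)$. Then the function \[ Z\longmapsto \det\left(\left(\frac{\partial}{\partial Z}-\sqrt{-1}\,k\,Y^{-1}\right)f\right), \] i.e. the determinant of the $g\times g$ matrix whose $(i,j)$ entry is $\partial_{ij}f(Z)-\sqrt{-1}\,k\,(Y^{-1})_{ij}f(Z)$, belongs to $\widetilde{M}_{2kg+2}(\Gamma_g)$.
   Context: $\mathbb H_g=\{Z=X+\sqrt{-1}Y\in M(g,\mathbb C): Z^t=Z,\ Y>0\}$ is the Siegel upper half space of degree $g$, with $Y=\mathrm{Im}(Z)$. $\Gamma_g=\mathrm{Sp}(2g,\mathbb Z)=\{M\in GL(2g,\mathbb Z): MJM^t=J\}$, $J=\begin{pmatrix}0&I_g\\-I_g&0\end{pmatrix}$, acting on $\mathbb H_g$ by $\gamma(Z)=(AZ+B)(CZ+D)^{-1}$ for $\gamma=\begin{pmatrix}A&B\\C&D\end{pmatrix}$ ($g\times g$ blocks). $M_{m}(\Gamma_g)$ is the space of (scalar-valued) Siegel modular forms of weight $m$: holomorphic $f:\mathbb H_g\to\mathbb C$ with $f(\gamma Z)=\det(CZ+D)^{m}f(Z)$ for all $\gamma\in\Gamma_g$ (with the usual holomorphy condition at $\infty$ when $g=1$). $\widetilde M_m(\Gamma_g)$ is the space of $C^\infty$ functions $F$ on $\mathbb H_g$ with $F(\gamma Z)=\det(CZ+D)^mF(Z)$ for all $\gamma\in\Gamma_g$. Writing $Z=(Z_{ij})$ with $Z_{ij}=Z_{ji}$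 and using $\{Z_{ij}\}_{i\le j}$ as holomorphic coordinates, $\frac{\partial}{\partial Z}=(\partial_{ij})_{g\times g}$ with $\partial_{ij}=\frac{1+\delta(i,j)}{2}\frac{\partial}{\partial Z_{ij}}$ (for $i>j$, $\partial/\partial Z_{ij}$ means $\partial/\partial Z_{ji}$), $\delta$ the Kronecker delta. *)

theory Defs
  imports "HOL-Analysis.Analysis"
begin

text \<open>
  The degree \<open>g\<close> is the cardinality of the index type \<open>'n\<close>.
\<close>

definition Im_mat :: "complex ^ 'n ^ 'n \<Rightarrow> real ^ 'n ^ 'n" where
  "Im_mat Z = (\<chi> i j. Im (Z $ i $ j))"

definition pos_def :: "real ^ 'n ^ 'n \<Rightarrow> bool" where
  "pos_def Y \<longleftrightarrow> transpose Y = Y \<and> (\<forall>x. x \<noteq> 0 \<longrightarrow> x \<bullet> (Y *v x) > 0)"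

definition siegel_space :: "(complex ^ 'n ^ 'n) set" where
  "siegel_space = {Z. transpose Z = Z \<and> pos_def (Im_mat Z)}"

text \<open>
  Matrices of size \<open>2g\<close> are indexed by \<open>'n + 'n\<close>; \<open>Inl\<close> is the first
  block of \<open>g\<close> indices and \<open>Inr\<close> the second.
\<close>

definition symp_J :: "int ^ ('n::finite + 'n) ^ ('n + 'n)" where
  "symp_J = (\<chi> a b. case (a, b) of
       (Inl i, Inr j) \<Rightarrow> if i = j then 1 else 0
     | (Inr i, Inl j) \<Rightarrow> if i = j then - 1 else 0
     | _ \<Rightarrow> 0)"

definition siegel_group :: "(int ^ ('n::finite + 'n) ^ ('n + 'n)) set" where
  "siegel_group = {M. invertible M \<and> M ** symp_J ** transpose M = symp_J}"

definition block_A :: "int ^ ('n::finite + 'n) ^ ('n + 'n) \<Rightarrow> complex ^ 'n ^ 'n" where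
  "block_A M = (\<chi> i j. of_int (M $ Inl i $ Inl j))"

definition block_B :: "int ^ ('n::finite + 'n) ^ ('n + 'n) \<Rightarrow> complex ^ 'n ^ 'n" where
  "block_B M = (\<chi> i j. of_int (M $ Inl i $ Inr j))"

definition block_C :: "int ^ ('n::finite + 'n) ^ ('n + 'n) \<Rightarrow> complex ^ 'n ^ 'n" where
  "block_C M = (\<chi> i j. of_int (M $ Inr i $ Inl j))"

definition block_D :: "int ^ ('n::finite + 'n) ^ ('n + 'n) \<Rightarrow> complex ^ 'n ^ 'n" where
  "block_D M = (\<chi> i j. of_int (M $ Inr i $ Inr j))"

definition siegel_factor :: "int ^ ('n::finite + 'n) ^ ('n + 'n) \<Rightarrow> complex ^ 'n ^ 'n \<Rightarrow> complex ^ 'n ^ 'n" where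
  "siegel_factor M Z = block_C M ** Z + block_D M"

definition siegel_act :: "int ^ ('n::finite + 'n) ^ ('n + 'n) \<Rightarrow> complex ^ 'n ^ 'n \<Rightarrow> complex ^ 'n ^ 'n" where
  "siegel_act M Z = (block_A M ** Z + block_B M) ** matrix_inv (siegel_factor M Z)"

definition modular_of_weight :: "nat \<Rightarrow> (complex ^ 'n ^ 'n \<Rightarrow> complex) \<Rightarrow> bool" where
  "modular_of_weight m F \<longleftrightarrow> (\<forall>M \<in> siegel_group. \<forall>Z \<in> siegel_space.
     F (siegel_act M Z) = det (siegel_factor M Z) ^ m * F Z)"

text \<open>
  The Siegel space is a relatively open subset of the space of symmetric
  matrices, not an open subset of \<open>complex ^ 'n ^ 'n\<close>.  Derivatives are
  therefore taken within it: a derivative within \<open>siegel_space\<close> is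
  determined exactly on symmetric matrices, and its values on other
  directions are irrelevant.

  Holomorphy in several variables is complex differentiability at every
  point, i.e. the existence of a complex-linear total derivative.
\<close>

definition siegel_holomorphic :: "(complex ^ 'n ^ 'n \<Rightarrow> complex) \<Rightarrow> bool" where
  "siegel_holomorphic f \<longleftrightarrow> (\<forall>Z \<in> siegel_space. \<exists>D.
     (f has_derivative D) (at Z within siegel_space) \<and>
     (\<forall>c V. transpose V = V \<longrightarrow> D (\<chi> i j. c * V $ i $ j) = c * D V))"

text \<open>
  \<open>C\<^sup>n\<close> functions on a relatively open subset \<open>S\<close> of an affine
  subspace (real differentiability).  The derivative is existentially
  quantified because within such an \<open>S\<close> it is only unique along
  directions of the subspace; along complementary directions it may always be
  chosen to vanish, so quantifying over all \<open>v\<close> imposes nothing extra.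
\<close>

primrec Cn_on :: "nat \<Rightarrow> ('a::real_normed_vector \<Rightarrow> 'b::real_normed_vector) \<Rightarrow> 'a set \<Rightarrow> bool" where
  "Cn_on 0 F S \<longleftrightarrow> continuous_on S F"
| "Cn_on (Suc n) F S \<longleftrightarrow> (\<exists>F'. (\<forall>x \<in> S. (F has_derivative F' x) (at x within S)) \<and>
     (\<forall>v. Cn_on n (\<lambda>x. F' x v) S))"

definition Cinf_on :: "('a::real_normed_vector \<Rightarrow> 'b::real_normed_vector) \<Rightarrow> 'a set \<Rightarrow> bool" where
  "Cinf_on F S \<longleftrightarrow> (\<forall>n. Cn_on n F S)"

text \<open>
  For \<open>g = 1\<close>: \<open>f\<close> is a function of \<open>q = exp (2 \<pi> \<i> z)\<close> that is holomorphic
  also at \<open>q = 0\<close>.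
\<close>

definition holomorphic_at_cusp :: "(complex ^ 'n ^ 'n \<Rightarrow> complex) \<Rightarrow> bool" where
  "holomorphic_at_cusp f \<longleftrightarrow> (\<exists>\<phi>. \<phi> holomorphic_on ball 0 1 \<and>
     (\<forall>Z \<in> siegel_space. \<forall>i. f Z = \<phi> (exp (2 * of_real pi * \<i> * Z $ i $ i))))"

text \<open>
  Functions are total in the logic; only their values on \<open>siegel_space\<close> matter.
\<close>

definition siegel_modular_forms :: "nat \<Rightarrow> (complex ^ 'n ^ 'n \<Rightarrow> complex) set" where
  "siegel_modular_forms m = {f. siegel_holomorphic f \<and> modular_of_weight m f \<and>
     (CARD('n) = 1 \<longrightarrow> holomorphic_at_cusp f)}"

definition smooth_siegel_modular_forms :: "nat \<Rightarrow> (complex ^ 'n ^ 'n \<Rightarrow> complex) set" where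
  "smooth_siegel_modular_forms m = {F. Cinf_on F siegel_space \<and> modular_of_weight m F}"

text \<open>
  The partial derivative with respect to the coordinate \<open>Z\<^sub>i\<^sub>j = Z\<^sub>j\<^sub>i\<close> on
  symmetric matrices: the entries \<open>(i,j)\<close> and \<open>(j,i)\<close> vary together, all
  others are fixed.
\<close>

definition coord_deriv :: "'n \<Rightarrow> 'n \<Rightarrow> (complex ^ 'n ^ 'n \<Rightarrow> complex) \<Rightarrow> complex ^ 'n ^ 'n \<Rightarrow> complex" where
  "coord_deriv i j f Z =
     deriv (\<lambda>w. f (\<chi> a b. if {a, b} = {i, j} then w else Z $ a $ b)) (Z $ i $ j)"

definition siegel_partial :: "'n \<Rightarrow> 'n \<Rightarrow> (complex ^ 'n ^ 'n \<Rightarrow> complex) \<Rightarrow> complex ^ 'n ^ 'n \<Rightarrow> complex" where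
  "siegel_partial i j f Z = (1 + (if i = j then 1 else 0)) / 2 * coord_deriv i j f Z"

end

theory Submission
  imports Defs "HOL-Complex_Analysis.Cauchy_Integral_Formula"
begin

text \<open>
  Write \<open>W = C Z + D\<close> and \<open>P\<close> for the matrix of partial derivatives of \<open>f\<close>.
  For symmetric \<open>Z'\<close>, \<open>Z\<close> the symplectic relations give
  \<open>\<gamma> Z' - \<gamma> Z = W'\<^sup>-\<^sup>t (Z' - Z) W\<^sup>-\<^sup>1\<close>. Letting \<open>Z'\<close> tend to \<open>Z\<close>, the derivative of \<open>\<gamma>\<close> is
  \<open>V \<mapsto> W\<^sup>-\<^sup>t V W\<^sup>-\<^sup>1\<close>; taking the complex conjugate of \<open>Z\<close> for one of the two points yields
  \<open>Im (\<gamma> Z)\<^sup>-\<^sup>1 = W Y\<^sup>-\<^sup>1 W\<^sup>t - 2 \<i> C W\<^sup>t\<close>. Differentiating \<open>f (\<gamma> Z) = (det W)\<^sup>m f Z\<close> produces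
  \<open>P (\<gamma> Z) = (det W)\<^sup>m (W P W\<^sup>t + m f C W\<^sup>t)\<close>, and for \<open>m = 2 k\<close> the two anomalous terms
  \<open>C W\<^sup>t\<close> cancel in \<open>P - \<i> k Y\<^sup>-\<^sup>1 f\<close>, whose determinant therefore has weight
  \<open>2 k g + 2\<close>. For smoothness, \<open>f\<close> is composed with symmetrization, which turns it into a
  holomorphic function on an open set of all complex matrices.
\<close>

section \<open>Smoothness of holomorphic functions of several variables\<close>

definition cscale :: "complex \<Rightarrow> complex ^ 'n ^ 'm \<Rightarrow> complex ^ 'n ^ 'm" where
  "cscale c V = (\<chi> i j. c * V $ i $ j)"

lemma cscale_nth [simp]: "cscale c V $ i $ j = c * V $ i $ j"
  by (simp add: cscale_def)

lemma cscale_zero [simp]: "cscale 0 V = 0"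
  by (simp add: vec_eq_iff)

lemma linear_cscale_left: "linear (\<lambda>t. cscale t V)"
  by (rule linearI) (simp_all add: vec_eq_iff algebra_simps)

lemma bounded_linear_cscale_left: "bounded_linear (\<lambda>t. cscale t V)"
  using linear_cscale_left linear_conv_bounded_linear by blast

lemma continuous_on_cscale_left [continuous_intros]:
  "continuous_on S g \<Longrightarrow> continuous_on S (\<lambda>x. cscale (g x) V)"
  using bounded_linear.continuous_on[OF bounded_linear_cscale_left] .

text \<open>The derivative \<open>D\<close> is an explicit argument so that its values in a fixed
  direction form a new function to which the notion applies again. Additivity is already part of
  \<open>has_derivative\<close>; only complex homogeneity is added.\<close>

definition complex_deriv_on ::
  "(complex ^ 'n ^ 'm \<Rightarrow> complex) \<Rightarrow> (complex ^ 'n ^ 'm \<Rightarrow> complex ^ 'n ^ 'm \<Rightarrow> complex)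
    \<Rightarrow> (complex ^ 'n ^ 'm) set \<Rightarrow> bool" where
  "complex_deriv_on f D U \<longleftrightarrow> (\<forall>Z\<in>U. (f has_derivative D Z) (at Z) \<and>
     (\<forall>c V. D Z (cscale c V) = c * D Z V))"

lemma complex_deriv_on_continuous:
  "complex_deriv_on f D U \<Longrightarrow> continuous_on U f"
  by (auto simp: complex_deriv_on_def intro!: continuous_at_imp_continuous_on has_derivative_continuous)

lemma has_field_derivative_along_line:
  assumes "(f has_derivative D) (at (Z + cscale t V))"
    and "\<And>c V. D (cscale c V) = c * D V"
  shows "((\<lambda>t. f (Z + cscale t V)) has_field_derivative D V) (at t)"
proof -
  have "((\<lambda>t. Z + cscale t V) has_derivative (\<lambda>t. cscale t V)) (at t)"
    using has_derivative_add[OF has_derivative_const bounded_linear_imp_has_derivative[OF bounded_linear_cscale_left]]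
    by force
  from has_derivative_compose[OF this assms(1)]
  show ?thesis
    by (simp add: assms(2) has_field_derivative_def mult.commute[of _ "D V"] mult_commute_abs)
qed

text \<open>One radius \<open>r\<close> serves all base points near \<open>Z0\<close>, so that a
  single family of circles represents the derivative on a whole ball. Half of the distance
  \<open>d\<close> is spent on the base point, half on the displacement.\<close>

lemma open_line_segment_nbhd:
  fixes V :: "complex ^ 'n ^ 'm"
  assumes "open U" "Z0 \<in> U"
  obtains e r where "e > 0" "r > 0"
    "\<And>Z t. Z \<in> ball Z0 e \<Longrightarrow> norm t \<le> r \<Longrightarrow> Z + cscale t V \<in> U"
proof -
  obtain d where d: "d > 0" "ball Z0 d \<subseteq> U"
    using assms openE by blast
  obtain B where B: "B > 0" "\<And>t. norm (cscale t V) \<le> B * norm t"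
    using linear_bounded_pos[OF linear_cscale_left] by blast
  show ?thesis
  proof
    show "d / 2 > 0" "d / (2 * B) > 0" using d B by auto
    fix Z t assume Z: "Z \<in> ball Z0 (d / 2)" and t: "norm (t::complex) \<le> d / (2 * B)"
    have "norm (cscale t V) \<le> d / 2"
      using B(2)[of t] mult_left_mono[OF t, of B] B(1) by (simp add: field_simps)
    moreover have "norm (Z0 - Z) < d / 2" using Z by (simp add: dist_norm)
    ultimately have "norm (Z0 - Z - cscale t V) < d"
      using norm_triangle_ineq4[of "Z0 - Z" "cscale t V"] by linarith
    then show "Z + cscale t V \<in> U"
      using d by (auto simp: dist_norm algebra_simps)
  qed
qed

text \<open>Cauchy's formula for the derivative at \<open>0\<close> of
  \<open>t \<mapsto> f (Z + t V)\<close>. On the circle \<open>u\<close>, the factor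
  \<open>2 \<pi> \<i> u\<close> from the parametrization reduces \<open>1 / u^2\<close> to
  \<open>1 / u\<close> and cancels the constant. The right side involves values of \<open>f\<close>
  only, so regularity in \<open>Z\<close> can be studied under the integral.\<close>

lemma directional_derivative_Cauchy:
  assumes D: "complex_deriv_on f D U"
    and seg: "\<And>t. norm t \<le> r \<Longrightarrow> Z + cscale t V \<in> U" and r: "r > 0"
  shows "D Z V = integral {0..1}
    (\<lambda>s. f (Z + cscale (r * exp (2 * of_real pi * \<i> * of_real s)) V)
        / (r * exp (2 * of_real pi * \<i> * of_real s)))"
proof -
  let ?h = "\<lambda>t. f (Z + cscale t V)"
  have der: "(?h has_field_derivative D (Z + cscale t V) V) (at t)" if "norm t \<le> r" for t
    using D seg[OF that] by (intro has_field_derivative_along_line) (auto simp: complex_deriv_on_def)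
  have "continuous_on (cball 0 r) ?h"
    using der by (intro DERIV_continuous_on) (auto intro: has_field_derivative_at_within)
  moreover have "?h holomorphic_on ball 0 r"
    unfolding holomorphic_on_open[OF open_ball]
    by (intro ballI exI, rule der) auto
  ultimately have "(?h has_field_derivative
      1 / (2 * of_real pi * \<i>) * contour_integral (circlepath 0 r) (\<lambda>u. ?h u / (u - 0)\<^sup>2)) (at 0)"
    using Cauchy_derivative_integral_circlepath(2)[of 0 r ?h 0] r by auto
  then have "D Z V = 1 / (2 * of_real pi * \<i>) * contour_integral (circlepath 0 r) (\<lambda>u. ?h u / u\<^sup>2)"
    using DERIV_unique[OF der[of 0]] r by simp
  also have "\<dots> = 1 / (2 * of_real pi * \<i>) * integral {0..1}
     (\<lambda>s. (2 * of_real pi * \<i>) * (?h (r * exp (2 * of_real pi * \<i> * of_real s))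
        / (r * exp (2 * of_real pi * \<i> * of_real s))))"
    unfolding contour_integral_integral
    using r by (intro arg_cong[where f="(*) (1 / (2 * of_real pi * \<i>))"] integral_cong)
      (simp only: vector_derivative_circlepath, simp add: circlepath power2_eq_square field_simps)
  finally show ?thesis
    unfolding integral_mult_right by simp
qed

text \<open>Near \<open>Z0\<close> the derivative is an integral over a compact interval whose
  integrand is jointly continuous in \<open>Z\<close> and the parameter.\<close>

lemma complex_deriv_on_directional_continuous:
  assumes "open U" and D: "complex_deriv_on f D U"
  shows "continuous_on U (\<lambda>Z. D Z V)"
proof -
  have "isCont (\<lambda>Z. D Z V) Z0" if Z0: "Z0 \<in> U" for Z0
  proof -
    obtain e r where er: "e > 0" "r > 0"
      "\<And>Z t. Z \<in> ball Z0 e \<Longrightarrow> norm t \<le> r \<Longrightarrow> Z + cscale t V \<in> U"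
      using open_line_segment_nbhd[OF \<open>open U\<close> Z0] by blast
    let ?H = "\<lambda>Z s. f (Z + cscale (r * exp (2 * of_real pi * \<i> * of_real s)) V)
        / (r * exp (2 * of_real pi * \<i> * of_real s))"
    have "continuous_on (ball Z0 e) (\<lambda>Z. integral (cbox 0 1) (?H Z))"
    proof (rule integral_continuous_on_param)
      have "continuous_on (ball Z0 e \<times> cbox 0 1)
          (\<lambda>x. f (fst x + cscale (r * exp (2 * of_real pi * \<i> * of_real (snd x))) V))"
        using er by (intro continuous_on_compose2[OF complex_deriv_on_continuous[OF D]] continuous_intros)
          (auto simp: norm_mult)
      then show "continuous_on (ball Z0 e \<times> cbox 0 1) (\<lambda>(Z, s). ?H Z s)"
        unfolding split_def using er by (intro continuous_intros) auto
    qed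
    moreover have "D Z V = integral (cbox 0 1) (?H Z)" if "Z \<in> ball Z0 e" for Z
      using directional_derivative_Cauchy[OF D er(3)[OF that] er(2)] by simp
    ultimately have "continuous_on (ball Z0 e) (\<lambda>Z. D Z V)"
      by (rule continuous_on_eq[OF _ sym])
    then show ?thesis
      using er(1) by (auto simp: continuous_on_eq_continuous_at)
  qed
  then show ?thesis
    by (simp add: continuous_at_imp_continuous_on)
qed

text \<open>
  Differentiation under Cauchy's integral needs continuity of the derivative, which is not part
  of the notion of holomorphy used here; it comes from the preceding lemma, that is, from
  Cauchy's integral for the derivative and continuity of \<open>f\<close> alone.
\<close>

lemma complex_deriv_on_directional_differentiable:
  fixes f :: "complex ^ 'n ^ 'm \<Rightarrow> complex"
  assumes "open U" and D: "complex_deriv_on f D U"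
  shows "\<exists>D'. complex_deriv_on (\<lambda>Z. D Z V) D' U"
proof -
  have "\<exists>L. ((\<lambda>Z. D Z V) has_derivative L) (at Z0) \<and> (\<forall>c W. L (cscale c W) = c * L W)"
    if Z0: "Z0 \<in> U" for Z0
  proof -
    obtain e r where er: "e > 0" "r > 0"
      "\<And>Z t. Z \<in> ball Z0 e \<Longrightarrow> norm t \<le> r \<Longrightarrow> Z + cscale t V \<in> U"
      using open_line_segment_nbhd[OF \<open>open U\<close> Z0] by blast
    let ?u = "\<lambda>s. r * exp (2 * of_real pi * \<i> * of_real s) :: complex"
    let ?H = "\<lambda>Z s. f (Z + cscale (?u s) V) / ?u s"
    \<comment> \<open>The derivative of the integrand \<open>?H\<close> in \<open>Z\<close>, bundled
      as a bounded operator because the Leibniz rule integrates operators.\<close>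
    define G where "G Z s = Blinfun (\<lambda>W. D (Z + cscale (?u s) V) W / ?u s)" for Z s
    have bl: "bounded_linear (D Z)" if "Z \<in> U" for Z
      using D that by (auto simp: complex_deriv_on_def intro: has_derivative_bounded_linear)
    have inU: "Z + cscale (?u s) V \<in> U" if "Z \<in> ball Z0 e" for Z s
      using er that by (auto simp: norm_mult)
    have G: "blinfun_apply (G Z s) = (\<lambda>W. D (Z + cscale (?u s) V) W / ?u s)"
      if "Z \<in> ball Z0 e" for Z s
      unfolding G_def
      by (rule bounded_linear_Blinfun_apply)
         (intro bounded_linear_compose[OF bounded_linear_divide] bl inU that)
    have contD: "continuous_on (ball Z0 e \<times> cbox 0 1)
          (\<lambda>x. D (fst x + cscale (?u (snd x)) V) W)" for W
      using inU by (intro continuous_on_compose2[OF complex_deriv_on_directional_continuous[OF \<open>open U\<close> D]] continuous_intros)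
        auto
    \<comment> \<open>In finite dimension, continuity in operator norm follows from continuity at
      each fixed vector \<open>W\<close>, which is \<open>contD\<close>.\<close>
    have contG: "continuous_on (ball Z0 e \<times> cbox 0 1) (\<lambda>(Z, s). G Z s)"
    proof (rule continuous_on_blinfun_componentwise)
      fix W :: "complex ^ 'n ^ 'm"
      have "continuous_on (ball Z0 e \<times> cbox 0 1)
          (\<lambda>x. D (fst x + cscale (?u (snd x)) V) W / ?u (snd x))"
        using er by (intro continuous_intros contD) auto
      then show "continuous_on (ball Z0 e \<times> cbox 0 1) (\<lambda>x. blinfun_apply (case x of (Z, s) \<Rightarrow> G Z s) W)"
        by (rule iffD1[OF continuous_on_cong, rotated -1]) (auto simp: split_def G)
    qed
    have "((\<lambda>Z. integral (cbox 0 1) (?H Z)) has_derivative integral (cbox 0 1) (G Z0)) (at Z0 within ball Z0 e)"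
    proof (rule leibniz_rule)
      fix Z s assume "Z \<in> ball Z0 e"
      have fd: "(f has_derivative D (Z + cscale (?u s) V)) (at (Z + cscale (?u s) V))"
        using D inU[OF \<open>Z \<in> ball Z0 e\<close>] by (auto simp: complex_deriv_on_def)
      have "((\<lambda>Z. Z + cscale (?u s) V) has_derivative (\<lambda>W. W)) (at Z within ball Z0 e)"
        by (auto intro!: derivative_eq_intros)
      from has_derivative_compose[OF this fd]
      show "((\<lambda>Z. ?H Z s) has_derivative blinfun_apply (G Z s)) (at Z within ball Z0 e)"
        unfolding G[OF \<open>Z \<in> ball Z0 e\<close>]
        by (intro bounded_linear.has_derivative[OF bounded_linear_divide])
    next
      fix Z assume Z: "Z \<in> ball Z0 e"
      show "?H Z integrable_on cbox 0 1"
        using er inU[OF Z] by (intro integrable_continuous continuous_intros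
            continuous_on_compose2[OF complex_deriv_on_continuous[OF D]]) auto
    next
      show "continuous_on (ball Z0 e \<times> cbox 0 1) (\<lambda>(Z, s). G Z s)" by (rule contG)
    qed (use er in auto)
    then have 1: "((\<lambda>Z. integral (cbox 0 1) (?H Z)) has_derivative integral (cbox 0 1) (G Z0)) (at Z0)"
      unfolding at_within_open[OF centre_in_ball[THEN iffD2, OF er(1)] open_ball] .
    have 2: "((\<lambda>Z. D Z V) has_derivative integral (cbox 0 1) (G Z0)) (at Z0)"
    proof (rule has_derivative_transform_within_open[OF 1])
      show "open (ball Z0 e)" "Z0 \<in> ball Z0 e" using er by auto
      fix Z assume "Z \<in> ball Z0 e"
      then show "integral (cbox 0 1) (?H Z) = D Z V"
        using directional_derivative_Cauchy[OF D er(3)[OF \<open>Z \<in> ball Z0 e\<close>] er(2)] by simp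
    qed
    have int: "G Z0 integrable_on cbox 0 1"
    proof (rule integrable_continuous)
      have "continuous_on (cbox 0 1) (\<lambda>s. (\<lambda>(Z, s). G Z s) (Z0, s))"
        by (rule continuous_on_compose2[OF contG]) (use er in \<open>auto intro!: continuous_intros\<close>)
      then show "continuous_on (cbox 0 1) (G Z0)" by simp
    qed
    \<comment> \<open>Evaluation at a vector commutes with the integral, so complex homogeneity
      passes from the integrand to the derivative.\<close>
    have "integral (cbox 0 1) (G Z0) (cscale c W) = c * integral (cbox 0 1) (G Z0) W" for c W
    proof -
      have "G Z0 s (cscale c W) = c * G Z0 s W" for s
        using D er(1) inU[of Z0 s] by (simp add: G complex_deriv_on_def)
      then show ?thesis
        unfolding blinfun_apply_integral[OF int] by simp
    qed
    with 2 show ?thesis by blast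
  qed
  then show ?thesis
    unfolding complex_deriv_on_def by metis
qed

text \<open>Induction on the order: every directional derivative is again complex differentiable on
  \<open>U\<close>, so the hypothesis reproduces itself.\<close>

lemma complex_deriv_on_imp_Cn_on:
  assumes "open U" "complex_deriv_on f D U"
  shows "Cn_on n f U"
  using assms(2)
proof (induction n arbitrary: f D)
  case 0
  then show ?case by (auto intro: complex_deriv_on_continuous)
next
  case (Suc n)
  have "\<forall>V. Cn_on n (\<lambda>Z. D Z V) U"
    using complex_deriv_on_directional_differentiable[OF \<open>open U\<close> Suc.prems] Suc.IH by blast
  then show ?case
    using Suc.prems unfolding Cn_on.simps complex_deriv_on_def
    by (intro exI[of _ D]) (simp add: has_derivative_at_withinI)
qed

section \<open>Calculus of smooth functions\<close>

lemma Cn_on_subset: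
  "Cn_on n f S \<Longrightarrow> T \<subseteq> S \<Longrightarrow> Cn_on n f T"
proof (induction n arbitrary: f)
  case 0
  then show ?case by (auto intro: continuous_on_subset)
next
  case (Suc n)
  then show ?case by simp (meson has_derivative_subset subsetD)
qed

lemma Cn_on_cong:
  assumes "Cn_on n f S" and "\<And>x. x \<in> S \<Longrightarrow> f x = g x"
  shows "Cn_on n g S"
proof (cases n)
  case 0
  then show ?thesis using assms by (auto intro: continuous_on_eq)
next
  case (Suc m)
  then obtain F' where "\<forall>x\<in>S. (f has_derivative F' x) (at x within S)" "\<forall>v. Cn_on m (\<lambda>x. F' x v) S"
    using assms by auto
  then show ?thesis
    unfolding Suc Cn_on.simps using assms(2)
    by (intro exI[of _ F']) (metis has_derivative_transform)
qed

lemma Cn_on_SucI: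
  assumes "\<And>x. x \<in> S \<Longrightarrow> (f has_derivative F' x) (at x within S)"
    and "\<And>v. Cn_on n (\<lambda>x. F' x v) S"
  shows "Cn_on (Suc n) f S"
  using assms by auto

lemma Cn_on_SucE:
  assumes "Cn_on (Suc n) f S"
  obtains F' where "\<And>x. x \<in> S \<Longrightarrow> (f has_derivative F' x) (at x within S)"
    and "\<And>v. Cn_on n (\<lambda>x. F' x v) S"
  using assms by auto

text \<open>The product rule and the rule for inverses contain undifferentiated factors, which must
  be known to be regular of the lower order as well.\<close>

lemma Cn_on_Suc_imp_Cn_on:
  "Cn_on (Suc n) f S \<Longrightarrow> Cn_on n f S"
proof (induction n arbitrary: f)
  case 0
  then show ?case by (auto intro: has_derivative_continuous_on)
next
  case (Suc n)
  obtain F' where F': "\<And>x. x \<in> S \<Longrightarrow> (f has_derivative F' x) (at x within S)"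
      "\<And>v. Cn_on (Suc n) (\<lambda>x. F' x v) S"
    using Cn_on_SucE[OF Suc.prems] by blast
  show ?case by (rule Cn_on_SucI[of S f F']) (simp_all only: F' Suc.IH)
qed

lemma Cn_on_const: "Cn_on n (\<lambda>x. c) S"
proof (induction n arbitrary: c)
  case (Suc n)
  then show ?case by (intro Cn_on_SucI[of _ _ "\<lambda>_ _. 0"]) auto
qed simp

lemma Cn_on_bounded_linear:
  assumes "bounded_linear h"
  shows "Cn_on n f S \<Longrightarrow> Cn_on n (\<lambda>x. h (f x)) S"
proof (induction n arbitrary: f)
  case 0
  then show ?case using assms by (simp add: bounded_linear.continuous_on)
next
  case (Suc n)
  obtain F' where "\<And>x. x \<in> S \<Longrightarrow> (f has_derivative F' x) (at x within S)"
      "\<And>v. Cn_on n (\<lambda>x. F' x v) S"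
    using Cn_on_SucE[OF Suc.prems] by blast
  then show ?case
    using Suc.IH
    by (intro Cn_on_SucI[of _ _ "\<lambda>x v. h (F' x v)"] bounded_linear.has_derivative[OF assms]) auto
qed

lemma Cn_on_ident: "Cn_on n (\<lambda>x. x) S"
proof (cases n)
  case (Suc m)
  then show ?thesis
    by (simp only: Suc) (rule Cn_on_SucI[of _ _ "\<lambda>_ v. v"], auto intro: Cn_on_const)
qed simp

lemma Cn_on_add:
  "Cn_on n f S \<Longrightarrow> Cn_on n g S \<Longrightarrow> Cn_on n (\<lambda>x. f x + g x) S"
proof (induction n arbitrary: f g)
  case 0
  then show ?case by (auto intro: continuous_intros)
next
  case (Suc n)
  obtain F' where F': "\<And>x. x \<in> S \<Longrightarrow> (f has_derivative F' x) (at x within S)"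
      "\<And>v. Cn_on n (\<lambda>x. F' x v) S"
    using Cn_on_SucE[OF Suc.prems(1)] by blast
  obtain G' where G': "\<And>x. x \<in> S \<Longrightarrow> (g has_derivative G' x) (at x within S)"
      "\<And>v. Cn_on n (\<lambda>x. G' x v) S"
    using Cn_on_SucE[OF Suc.prems(2)] by blast
  show ?case
    using F' G' by (intro Cn_on_SucI[of _ _ "\<lambda>x v. F' x v + G' x v"] has_derivative_add Suc.IH) auto
qed

lemma Cn_on_mult:
  fixes f g :: "'a::real_normed_vector \<Rightarrow> 'b::real_normed_algebra"
  shows "Cn_on n f S \<Longrightarrow> Cn_on n g S \<Longrightarrow> Cn_on n (\<lambda>x. f x * g x) S"
proof (induction n arbitrary: f g)
  case 0
  then show ?case by (auto intro: continuous_intros)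
next
  case (Suc n)
  obtain F' where F': "\<And>x. x \<in> S \<Longrightarrow> (f has_derivative F' x) (at x within S)"
      "\<And>v. Cn_on n (\<lambda>x. F' x v) S"
    using Cn_on_SucE[OF Suc.prems(1)] by blast
  obtain G' where G': "\<And>x. x \<in> S \<Longrightarrow> (g has_derivative G' x) (at x within S)"
      "\<And>v. Cn_on n (\<lambda>x. G' x v) S"
    using Cn_on_SucE[OF Suc.prems(2)] by blast
  show ?case
    using F' G' Suc.prems[THEN Cn_on_Suc_imp_Cn_on]
    by (intro Cn_on_SucI[of _ _ "\<lambda>x v. f x * G' x v + F' x v * g x"] has_derivative_mult Cn_on_add Suc.IH) auto
qed

lemma Cn_on_minus: "Cn_on n f S \<Longrightarrow> Cn_on n (\<lambda>x. - f x) S"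
  by (rule Cn_on_bounded_linear[OF bounded_linear_minus[OF bounded_linear_ident]])

lemma Cn_on_diff:
  "Cn_on n f S \<Longrightarrow> Cn_on n g S \<Longrightarrow> Cn_on n (\<lambda>x. f x - g x) S"
  using Cn_on_add[OF _ Cn_on_minus, of n f S g] by simp

lemma Cn_on_sum:
  "(\<And>i. i \<in> I \<Longrightarrow> Cn_on n (f i) S) \<Longrightarrow> Cn_on n (\<lambda>x. \<Sum>i\<in>I. f i x) S"
  by (induction I rule: infinite_finite_induct) (auto intro: Cn_on_const Cn_on_add)

lemma Cn_on_prod:
  fixes f :: "'i \<Rightarrow> 'a::real_normed_vector \<Rightarrow> 'b::real_normed_field"
  shows "(\<And>i. i \<in> I \<Longrightarrow> Cn_on n (f i) S) \<Longrightarrow> Cn_on n (\<lambda>x. \<Prod>i\<in>I. f i x) S"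
  by (induction I rule: infinite_finite_induct) (auto intro: Cn_on_const Cn_on_mult)

lemma Cn_on_inverse:
  fixes f :: "'a::real_normed_vector \<Rightarrow> 'b::real_normed_field"
  assumes "\<And>x. x \<in> S \<Longrightarrow> f x \<noteq> 0"
  shows "Cn_on n f S \<Longrightarrow> Cn_on n (\<lambda>x. inverse (f x)) S"
proof (induction n)
  case 0
  then show ?case using assms by (auto intro: continuous_intros)
next
  case (Suc n)
  obtain F' where F': "\<And>x. x \<in> S \<Longrightarrow> (f has_derivative F' x) (at x within S)"
      "\<And>v. Cn_on n (\<lambda>x. F' x v) S"
    using Cn_on_SucE[OF Suc.prems(1)] by blast
  show ?case
    using F' assms Suc.prems[THEN Cn_on_Suc_imp_Cn_on]
    by (intro Cn_on_SucI[of _ _ "\<lambda>x v. - (inverse (f x) * F' x v * inverse (f x))"]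
        has_derivative_inverse Cn_on_minus Cn_on_mult Suc.IH) auto
qed

lemma Cn_on_det:
  fixes A :: "'a::real_normed_vector \<Rightarrow> 'b::real_normed_field ^ 'n ^ 'n"
  assumes "\<And>i j. Cn_on n (\<lambda>x. A x $ i $ j) S"
  shows "Cn_on n (\<lambda>x. det (A x)) S"
  unfolding det_def by (intro Cn_on_sum Cn_on_mult Cn_on_prod Cn_on_const assms)

section \<open>Inverse matrices and Cramer's rule\<close>

lemma matrix_inv_unique:
  fixes A :: "'a::field ^ 'n ^ 'n"
  assumes "A ** B = mat 1"
  shows "matrix_inv A = B"
proof -
  have BA: "B ** A = mat 1" using assms matrix_left_right_inverse by blast
  have "A ** matrix_inv A = mat 1 \<and> matrix_inv A ** A = mat 1"
    unfolding matrix_inv_def using assms BA by (rule_tac someI[of _ B]) simp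
  then have "B ** (A ** matrix_inv A) = B" by simp
  then show ?thesis by (simp add: matrix_mul_assoc BA)
qed

lemma matrix_inv_inverse:
  fixes A :: "'a::field ^ 'n ^ 'n"
  assumes "det A \<noteq> 0"
  shows "A ** matrix_inv A = mat 1" "matrix_inv A ** A = mat 1"
proof -
  obtain B where "A ** B = mat 1" using assms invertible_det_nz invertible_def by blast
  then show "A ** matrix_inv A = mat 1" using matrix_inv_unique by metis
  then show "matrix_inv A ** A = mat 1" using matrix_left_right_inverse by blast
qed

text \<open>Column \<open>j\<close> of the inverse solves \<open>A x = e_j\<close>. Writing its
  entries as quotients of determinants makes them polynomials in the entries of \<open>A\<close>
  divided by \<open>det A\<close>, whence their smoothness.\<close>

lemma matrix_inv_cramer:
  fixes A :: "'a::field ^ 'n ^ 'n"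
  assumes "det A \<noteq> 0"
  shows "matrix_inv A $ k $ j = det (\<chi> i l. if l = k then (if i = j then 1 else 0) else A $ i $ l) / det A"
proof -
  have "A *v column j (matrix_inv A) = axis j 1"
    using matrix_inv_inverse(1)[OF assms]
    by (simp add: vec_eq_iff matrix_vector_mult_def matrix_matrix_mult_def column_def axis_def mat_def)
  then have "column j (matrix_inv A) = (\<chi> k. det (\<chi> i l. if l = k then axis j 1 $ i else A $ i $ l) / det A)"
    by (simp add: cramer[OF assms])
  then have "column j (matrix_inv A) $ k = det (\<chi> i l. if l = k then axis j 1 $ i else A $ i $ l) / det A"
    by simp
  then show ?thesis by (simp add: column_def axis_def cong: if_cong)
qed

lemma Cn_on_matrix_inv:
  fixes A :: "'a::real_normed_vector \<Rightarrow> 'b::real_normed_field ^ 'n ^ 'n"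
  assumes "\<And>i j. Cn_on n (\<lambda>x. A x $ i $ j) S" and "\<And>x. x \<in> S \<Longrightarrow> det (A x) \<noteq> 0"
  shows "Cn_on n (\<lambda>x. matrix_inv (A x) $ k $ l) S"
proof (rule Cn_on_cong)
  have "Cn_on n (\<lambda>x. (\<chi> i m. if m = k then if i = l then 1 else 0 else A x $ i $ m) $ i $ j) S" for i j
    by (cases "j = k"; cases "i = l") (simp_all add: assms Cn_on_const)
  then show "Cn_on n (\<lambda>x. det (\<chi> i m. if m = k then (if i = l then 1 else 0) else A x $ i $ m)
      * inverse (det (A x))) S"
    by (intro Cn_on_mult Cn_on_inverse Cn_on_det assms)
qed (simp add: matrix_inv_cramer assms divide_inverse)

section \<open>The action of the symplectic group\<close>

definition cmat :: "real ^ 'n ^ 'm \<Rightarrow> complex ^ 'n ^ 'm" where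
  "cmat Y = (\<chi> i j. of_real (Y $ i $ j))"

definition cnj_mat :: "complex ^ 'n ^ 'm \<Rightarrow> complex ^ 'n ^ 'm" where
  "cnj_mat Z = (\<chi> i j. cnj (Z $ i $ j))"

lemma UNIV_sum_split: "(\<Sum>a\<in>(UNIV :: ('a::finite + 'b::finite) set). h a)
    = (\<Sum>i\<in>UNIV. h (Inl i)) + (\<Sum>j\<in>UNIV. h (Inr j))"
  unfolding UNIV_Plus_UNIV[symmetric] Plus_def
  by (subst sum.union_disjoint) (auto simp: sum.reindex)

lemma symp_J_nth [simp]:
  "symp_J $ Inl i $ Inl j = 0" "symp_J $ Inl i $ Inr j = (if i = j then 1 else 0)"
  "symp_J $ Inr i $ Inl j = (if i = j then - 1 else 0)" "symp_J $ Inr i $ Inr j = 0"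
  by (simp_all add: symp_J_def)

lemma symp_form_nth:
  "(M ** symp_J ** transpose M) $ a $ b
    = (\<Sum>i\<in>UNIV. M $ a $ Inl i * M $ b $ Inr i - M $ a $ Inr i * M $ b $ Inl i)"
  by (simp add: matrix_matrix_mult_def transpose_def UNIV_sum_split if_distrib cong: if_cong)
    (simp add: sum_subtractf sum_negf)

lemma symp_form_transpose_nth:
  "(transpose M ** symp_J ** M) $ a $ b
    = (\<Sum>i\<in>UNIV. M $ Inl i $ a * M $ Inr i $ b - M $ Inr i $ a * M $ Inl i $ b)"
  using symp_form_nth[of "transpose M" a b] by (simp add: transpose_def transpose_transpose)

lemma symp_J_square:
  "(symp_J :: int ^ ('n::finite + 'n) ^ ('n + 'n)) ** symp_J = - mat 1"
proof -
  have "(symp_J ** symp_J :: int ^ ('n + 'n) ^ ('n + 'n)) $ a $ b = (- mat 1) $ a $ b" for a b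
    by (cases a; cases b) (simp_all add: matrix_matrix_mult_def UNIV_sum_split mat_def if_distrib if_distribR cong: if_cong)
  then show ?thesis by (simp add: vec_eq_iff)
qed

lemma matrix_mul_minus_left: "(- A) ** B = - (A ** (B :: 'a::ring_1 ^ 'n ^ 'm))"
  by (simp add: vec_eq_iff matrix_matrix_mult_def sum_negf)

lemma matrix_mul_minus_right: "A ** (- B) = - (A ** (B :: 'a::ring_1 ^ 'n ^ 'm))"
  by (simp add: vec_eq_iff matrix_matrix_mult_def sum_negf)

lemma matrix_diff_ldistrib: "A ** (B - C) = A ** B - A ** (C :: 'a::ring_1 ^ 'n ^ 'm)"
  by (simp add: vec_eq_iff matrix_matrix_mult_def sum_subtractf algebra_simps)

lemma matrix_diff_rdistrib: "(A - B) ** C = A ** C - B ** (C :: 'a::ring_1 ^ 'n ^ 'm)"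
  by (simp add: vec_eq_iff matrix_matrix_mult_def sum_subtractf algebra_simps)

lemma matrix_add_rdistrib: "(A + B) ** C = A ** C + B ** (C :: 'a::ring_1 ^ 'n ^ 'm)"
  by (simp add: vec_eq_iff matrix_matrix_mult_def sum.distrib algebra_simps)

lemma transpose_add: "transpose (A + B) = transpose A + transpose B"
  by (simp add: vec_eq_iff transpose_def)

lemma transpose_diff: "transpose (A - B) = transpose A - transpose B"
  by (simp add: vec_eq_iff transpose_def)

text \<open>From \<open>M J M^t = J\<close> and \<open>J^2 = -1\<close> the inverse of
  \<open>M\<close> is \<open>- J M^t J\<close>; inserting this into \<open>N M = 1\<close> gives the
  relation for the transpose. It turns relations between block rows into relations between block
  columns.\<close>

lemma siegel_group_transpose:
  fixes M :: "int ^ ('n::finite + 'n) ^ ('n + 'n)"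
  assumes "M \<in> siegel_group"
  shows "transpose M ** symp_J ** M = symp_J"
proof -
  obtain N where N: "M ** N = mat 1" "N ** M = mat 1"
    using assms by (auto simp: siegel_group_def invertible_def)
  have "symp_J ** transpose M = (N ** M) ** (symp_J ** transpose M)"
    by (simp add: N)
  also have "\<dots> = N ** (M ** symp_J ** transpose M)"
    by (simp only: matrix_mul_assoc)
  also have "\<dots> = N ** symp_J"
    using assms by (simp add: siegel_group_def)
  finally have "symp_J ** transpose M ** symp_J = - N"
    by (simp add: matrix_mul_assoc[symmetric] symp_J_square matrix_mul_minus_right)
  then have "symp_J ** (symp_J ** transpose M ** symp_J) ** M = - symp_J"
    by (simp add: matrix_mul_assoc[symmetric] N matrix_mul_minus_right matrix_mul_minus_left)
  then show ?thesis
    by (simp add: matrix_mul_assoc symp_J_square matrix_mul_minus_left)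
qed

text \<open>The first three relations compare block columns and drive the identity for
  \<open>Z' - Z\<close>; the fourth compares block rows and makes \<open>C W^t\<close>
  symmetric.\<close>

lemma siegel_group_blocks:
  assumes M: "M \<in> siegel_group"
  shows "transpose (block_A M) ** block_C M = transpose (block_C M) ** block_A M"
    and "transpose (block_B M) ** block_D M = transpose (block_D M) ** block_B M"
    and "transpose (block_A M) ** block_D M - transpose (block_C M) ** block_B M = mat 1"
    and "block_C M ** transpose (block_D M) = block_D M ** transpose (block_C M)"
proof -
  note defs = block_A_def block_B_def block_C_def block_D_def
  have 1: "(\<Sum>i\<in>UNIV. of_int (M $ Inl i $ a) * of_int (M $ Inr i $ b))
      - (\<Sum>i\<in>UNIV. of_int (M $ Inr i $ a) * of_int (M $ Inl i $ b))
      = (of_int (symp_J $ a $ b) :: complex)" for a b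
    using arg_cong[OF symp_form_transpose_nth[of M a b], of "of_int :: int \<Rightarrow> complex"]
    by (simp add: siegel_group_transpose[OF M] sum_subtractf)
  show "transpose (block_A M) ** block_C M = transpose (block_C M) ** block_A M"
    using 1[of "Inl _" "Inl _"] by (simp add: defs vec_eq_iff matrix_matrix_mult_def transpose_def)
  show "transpose (block_B M) ** block_D M = transpose (block_D M) ** block_B M"
    using 1[of "Inr _" "Inr _"] by (simp add: defs vec_eq_iff matrix_matrix_mult_def transpose_def)
  show "transpose (block_A M) ** block_D M - transpose (block_C M) ** block_B M = mat 1"
    using 1[of "Inl _" "Inr _"] by (simp add: defs vec_eq_iff matrix_matrix_mult_def transpose_def mat_def)
  have "(\<Sum>i\<in>UNIV. of_int (M $ a $ Inl i) * of_int (M $ b $ Inr i))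
      - (\<Sum>i\<in>UNIV. of_int (M $ a $ Inr i) * of_int (M $ b $ Inl i))
      = (of_int (symp_J $ a $ b) :: complex)" for a b
    using arg_cong[OF symp_form_nth[of M a b], of "of_int :: int \<Rightarrow> complex"] M
    by (simp add: siegel_group_def sum_subtractf)
  from this[of "Inr _" "Inr _"]
  show "block_C M ** transpose (block_D M) = block_D M ** transpose (block_C M)"
    by (simp add: defs vec_eq_iff matrix_matrix_mult_def transpose_def)
qed

section \<open>Numerator and denominator of the action\<close>

definition siegel_num :: "int ^ ('n::finite + 'n) ^ ('n + 'n) \<Rightarrow> complex ^ 'n ^ 'n \<Rightarrow> complex ^ 'n ^ 'n" where
  "siegel_num M Z = block_A M ** Z + block_B M"

text \<open>Expanding bilinearly in \<open>Z'\<close> and \<open>Z\<close>, the quadratic and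
  constant coefficients vanish by the block relations and the two linear ones are \<open>1\<close>
  and \<open>-1\<close>. This identity is used with equal points for symmetry, with nearby points
  for the derivative, and with a conjugate point for imaginary parts.\<close>

lemma siegel_num_factor:
  assumes M: "M \<in> siegel_group" and Z: "transpose Z' = Z'"
  shows "transpose (siegel_num M Z') ** siegel_factor M Z
    - transpose (siegel_factor M Z') ** siegel_num M Z = Z' - Z"
proof -
  note bl = siegel_group_blocks[OF M]
  let ?A = "block_A M" and ?B = "block_B M" and ?C = "block_C M" and ?D = "block_D M"
  \<comment> \<open>The transpose of the third block relation.\<close>
  have BC: "transpose ?B ** ?C - transpose ?D ** ?A = - mat 1"
    using arg_cong[OF bl(3), of transpose]
    by (simp add: transpose_diff matrix_transpose_mul algebra_simps)
  have "transpose (siegel_num M Z') ** siegel_factor M Z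
    - transpose (siegel_factor M Z') ** siegel_num M Z =
     Z' ** (transpose ?A ** ?C - transpose ?C ** ?A) ** Z
     + Z' ** (transpose ?A ** ?D - transpose ?C ** ?B)
     + (transpose ?B ** ?C - transpose ?D ** ?A) ** Z
     + (transpose ?B ** ?D - transpose ?D ** ?B)"
    by (simp add: siegel_num_def siegel_factor_def transpose_add matrix_transpose_mul Z
        matrix_add_ldistrib matrix_add_rdistrib matrix_diff_ldistrib matrix_diff_rdistrib
        matrix_mul_assoc)
  also have "\<dots> = Z' - Z"
    unfolding bl BC by (simp add: matrix_mul_minus_left)
  finally show ?thesis .
qed


lemma cscale_matrix_mul_left: "cscale c A ** B = cscale c (A ** B)"
  by (simp add: vec_eq_iff matrix_matrix_mult_def sum_distrib_left mult.assoc)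

lemma cscale_matrix_mul_right: "A ** cscale c B = cscale c (A ** B)"
  by (simp add: vec_eq_iff matrix_matrix_mult_def sum_distrib_left mult_ac)

lemma cscale_diff_right: "cscale c (A - B) = cscale c A - cscale c B"
  by (simp add: vec_eq_iff algebra_simps)

lemma transpose_cscale: "transpose (cscale c A) = cscale c (transpose A)"
  by (simp add: vec_eq_iff transpose_def)

lemma det_cscale: "det (cscale c (A :: complex ^ 'n ^ 'n)) = c ^ CARD('n) * det A"
proof -
  have "cscale c A = (\<chi> i. c *s A $ i)" by (simp add: vec_eq_iff)
  then show ?thesis using det_rows_mul[of "\<lambda>_. c" "\<lambda>i. A $ i"] by (simp add: vec_lambda_eta)
qed

lemma cmat_nth [simp]: "cmat Y $ i $ j = of_real (Y $ i $ j)"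
  by (simp add: cmat_def)

lemma cnj_mat_nth [simp]: "cnj_mat Z $ i $ j = cnj (Z $ i $ j)"
  by (simp add: cnj_mat_def)

lemma cnj_mat_mult: "cnj_mat (A ** B) = cnj_mat A ** cnj_mat B"
  by (simp add: vec_eq_iff matrix_matrix_mult_def)

lemma cmat_mult: "cmat (A ** B) = cmat A ** cmat B"
  by (simp add: vec_eq_iff matrix_matrix_mult_def)

lemma cmat_one: "cmat (mat 1) = mat 1"
  by (simp add: vec_eq_iff mat_def)

lemma cnj_mat_one: "cnj_mat (mat 1) = mat 1"
  by (simp add: vec_eq_iff mat_def)

lemma minus_cnj_mat: "Z - cnj_mat Z = cscale (2 * \<i>) (cmat (Im_mat Z))"
  by (simp add: vec_eq_iff Im_mat_def complex_eq_iff)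

lemma cnj_mat_siegel_factor: "cnj_mat (siegel_factor M Z) = siegel_factor M (cnj_mat Z)"
  by (simp add: vec_eq_iff siegel_factor_def matrix_matrix_mult_def block_C_def block_D_def)

lemma cnj_mat_siegel_num: "cnj_mat (siegel_num M Z) = siegel_num M (cnj_mat Z)"
  by (simp add: vec_eq_iff siegel_num_def matrix_matrix_mult_def block_A_def block_B_def)

text \<open>Bilinear rather than Hermitian, so that \<open>transpose\<close> is the adjoint;
  Hermitian forms arise by inserting \<open>cnj_vec\<close> explicitly.\<close>

definition dotc :: "complex ^ 'n \<Rightarrow> complex ^ 'n \<Rightarrow> complex" where
  "dotc u v = (\<Sum>i\<in>UNIV. u $ i * v $ i)"

definition cnj_vec :: "complex ^ 'n \<Rightarrow> complex ^ 'n" where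
  "cnj_vec v = (\<chi> i. cnj (v $ i))"

lemma cnj_vec_nth [simp]: "cnj_vec v $ i = cnj (v $ i)"
  by (simp add: cnj_vec_def)

lemma dotc_transpose: "dotc u (transpose A *v v) = dotc (A *v u) v"
  unfolding dotc_def matrix_vector_mult_def transpose_def
  by (simp add: sum_distrib_left sum_distrib_right) (subst sum.swap, simp add: mult_ac)

lemma cnj_mat_mult_cnj_vec: "cnj_mat A *v cnj_vec v = cnj_vec (A *v v)"
  by (simp add: vec_eq_iff matrix_vector_mult_def)

text \<open>For \<open>v = a + \<i> b\<close> the Hermitian form of a real symmetric
  \<open>Y\<close> is the sum of its quadratic forms at \<open>a\<close> and \<open>b\<close>; the
  imaginary parts cancel by symmetry.\<close>

lemma dotc_hermitian_pos:
  assumes Y: "pos_def Y" and v: "v \<noteq> 0"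
  shows "\<exists>r>0. dotc v (cmat Y *v cnj_vec v) = of_real r"
proof -
  define a where "a = (\<chi> i. Re (v $ i))"
  define b where "b = (\<chi> i. Im (v $ i))"
  have sym: "Y $ i $ j = Y $ j $ i" for i j
    using Y unfolding pos_def_def transpose_def by (metis vec_lambda_beta)
  have q: "x \<bullet> (Y *v y) = (\<Sum>i\<in>UNIV. \<Sum>j\<in>UNIV. Y $ i $ j * (x $ i * y $ j))" for x y
    by (simp add: inner_vec_def matrix_vector_mult_def sum_distrib_left mult_ac)
  have ab: "b \<bullet> (Y *v a) = a \<bullet> (Y *v b)"
    unfolding q by (subst sum.swap) (simp add: sym mult_ac)
  have d: "dotc v (cmat Y *v cnj_vec v)
      = (\<Sum>i\<in>UNIV. \<Sum>j\<in>UNIV. of_real (Y $ i $ j) * (v $ i * cnj (v $ j)))"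
    by (simp add: dotc_def matrix_vector_mult_def sum_distrib_left mult_ac)
  have "dotc v (cmat Y *v cnj_vec v) = of_real (a \<bullet> (Y *v a) + b \<bullet> (Y *v b))"
  proof (rule complex_eqI)
    show "Re (dotc v (cmat Y *v cnj_vec v)) = Re (of_real (a \<bullet> (Y *v a) + b \<bullet> (Y *v b)))"
      unfolding d q by (simp add: a_def b_def sum.distrib algebra_simps)
    show "Im (dotc v (cmat Y *v cnj_vec v)) = Im (of_real (a \<bullet> (Y *v a) + b \<bullet> (Y *v b)))"
      using ab unfolding d q by (simp add: a_def b_def sum_subtractf algebra_simps)
  qed
  moreover have "a \<noteq> 0 \<or> b \<noteq> 0"
    using v by (auto simp: a_def b_def vec_eq_iff complex_eq_iff)
  then have "a \<bullet> (Y *v a) + b \<bullet> (Y *v b) > 0"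
  proof
    assume "a \<noteq> 0"
    then show ?thesis using Y unfolding pos_def_def
      by (cases "b = 0") (auto intro: add_pos_pos)
  next
    assume "b \<noteq> 0"
    then show ?thesis using Y unfolding pos_def_def
      by (cases "a = 0") (auto intro: add_pos_pos)
  qed
  ultimately show ?thesis by blast
qed

lemma det_nonzeroI:
  fixes A :: "'a::field ^ 'n ^ 'n"
  assumes "\<And>v. A *v v = 0 \<Longrightarrow> v = 0"
  shows "det A \<noteq> 0"
proof -
  have "\<exists>B. B ** A = mat 1" using assms by (simp add: matrix_left_invertible_ker)
  then show ?thesis by (simp add: invertible_det_nz[symmetric] invertible_left_inverse)
qed

lemma pos_def_det_nonzero: "pos_def Y \<Longrightarrow> det Y \<noteq> 0"
  by (rule det_nonzeroI) (force simp: pos_def_def)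

lemma siegel_spaceD:
  "Z \<in> siegel_space \<Longrightarrow> transpose Z = Z" "Z \<in> siegel_space \<Longrightarrow> pos_def (Im_mat Z)"
  by (simp_all add: siegel_space_def)

text \<open>If \<open>W v = 0\<close>, then pairing \<open>Z - cnj_mat Z\<close> with
  \<open>v\<close> and its conjugate gives \<open>0\<close>, since each term of
  \<open>siegel_num_factor\<close> contains \<open>W v\<close> or its conjugate. But the value is
  \<open>2 \<i>\<close> times a positive number.\<close>

lemma siegel_factor_det_nonzero:
  assumes M: "M \<in> siegel_group" and Z: "Z \<in> siegel_space"
  shows "det (siegel_factor M Z) \<noteq> 0"
proof (rule det_nonzeroI, rule ccontr)
  fix v assume v: "siegel_factor M Z *v v = 0" "v \<noteq> 0"
  have "dotc v ((Z - cnj_mat Z) *v cnj_vec v)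
    = dotc (siegel_num M Z *v v) (siegel_factor M (cnj_mat Z) *v cnj_vec v)
      - dotc (siegel_factor M Z *v v) (siegel_num M (cnj_mat Z) *v cnj_vec v)"
    by (simp only: siegel_num_factor[OF M siegel_spaceD(1)[OF Z], symmetric] dotc_transpose[symmetric]
        matrix_vector_mul_assoc)
      (simp add: dotc_def matrix_vector_mult_diff_rdistrib sum_subtractf algebra_simps)
  also have "\<dots> = 0"
    by (simp only: cnj_mat_siegel_factor[symmetric] cnj_mat_mult_cnj_vec v) (simp add: dotc_def)
  also have "dotc v ((Z - cnj_mat Z) *v cnj_vec v) = 2 * \<i> * dotc v (cmat (Im_mat Z) *v cnj_vec v)"
    unfolding minus_cnj_mat by (simp add: dotc_def matrix_vector_mult_def sum_distrib_left mult_ac)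
  finally show False
    using dotc_hermitian_pos[OF siegel_spaceD(2)[OF Z] v(2)] by auto
qed

section \<open>Image points and their imaginary parts\<close>

lemma transpose_matrix_inv_mult:
  fixes A :: "complex ^ 'n ^ 'n"
  assumes "det A \<noteq> 0"
  shows "transpose (matrix_inv A) ** transpose A = mat 1"
    "transpose A ** transpose (matrix_inv A) = mat 1"
  by (simp_all add: matrix_transpose_mul[symmetric] matrix_inv_inverse[OF assms])

text \<open>For equal points \<open>siegel_num_factor\<close> says that \<open>W^t P\<close> is
  symmetric, \<open>P\<close> being the numerator. Hence the inverse of \<open>W\<close> may be
  moved to the left, which shows that \<open>\<gamma> Z\<close> is symmetric.\<close>

lemma siegel_act_transpose_eq:
  assumes M: "M \<in> siegel_group" and Z: "transpose Z = Z" and W: "det (siegel_factor M Z) \<noteq> 0"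
  shows "siegel_act M Z = transpose (matrix_inv (siegel_factor M Z)) ** transpose (siegel_num M Z)"
proof -
  let ?W = "siegel_factor M Z" and ?P = "siegel_num M Z"
  have "transpose ?W ** ?P = transpose ?P ** ?W"
    using siegel_num_factor[OF M Z, of Z] by simp
  then have "transpose (matrix_inv ?W) ** (transpose ?W ** ?P) ** matrix_inv ?W
    = transpose (matrix_inv ?W) ** (transpose ?P ** ?W) ** matrix_inv ?W" by simp
  then have "(transpose (matrix_inv ?W) ** transpose ?W) ** (?P ** matrix_inv ?W)
    = transpose (matrix_inv ?W) ** transpose ?P ** (?W ** matrix_inv ?W)"
    by (simp only: matrix_mul_assoc)
  then show ?thesis
    by (simp add: transpose_matrix_inv_mult[OF W] matrix_inv_inverse[OF W] siegel_act_def siegel_num_def)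
qed

text \<open>With the inverse placed on the left at \<open>Z'\<close> and on the right at
  \<open>Z\<close>, the difference is \<open>siegel_num_factor\<close> enclosed between the two
  inverses.\<close>

lemma siegel_act_diff:
  assumes M: "M \<in> siegel_group" and Z': "transpose Z' = Z'"
    and W': "det (siegel_factor M Z') \<noteq> 0" and W: "det (siegel_factor M Z) \<noteq> 0"
  shows "siegel_act M Z' - siegel_act M Z
    = transpose (matrix_inv (siegel_factor M Z')) ** (Z' - Z) ** matrix_inv (siegel_factor M Z)"
proof -
  let ?W = "siegel_factor M Z" and ?P = "siegel_num M Z"
  let ?W' = "siegel_factor M Z'" and ?P' = "siegel_num M Z'"
  have "transpose (matrix_inv ?W') ** (Z' - Z) ** matrix_inv ?W =
     transpose (matrix_inv ?W') ** transpose ?P' ** (?W ** matrix_inv ?W)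
     - (transpose (matrix_inv ?W') ** transpose ?W') ** (?P ** matrix_inv ?W)"
    by (simp only: siegel_num_factor[OF M Z', of Z, symmetric] matrix_diff_ldistrib
        matrix_diff_rdistrib matrix_mul_assoc)
  also have "\<dots> = transpose (matrix_inv ?W') ** transpose ?P' - ?P ** matrix_inv ?W"
    by (simp add: transpose_matrix_inv_mult[OF W'] matrix_inv_inverse[OF W])
  finally show ?thesis
    unfolding siegel_act_transpose_eq[OF M Z' W'] by (simp add: siegel_act_def siegel_num_def)
qed

lemma cnj_mat_matrix_inv:
  "det A \<noteq> 0 \<Longrightarrow> matrix_inv (cnj_mat A) = cnj_mat (matrix_inv A)"
  by (rule matrix_inv_unique) (simp add: cnj_mat_mult[symmetric] matrix_inv_inverse cnj_mat_one)

lemma cmat_matrix_inv: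
  "det A \<noteq> 0 \<Longrightarrow> matrix_inv (cmat A) = cmat (matrix_inv A)"
  by (rule matrix_inv_unique) (simp add: cmat_mult[symmetric] matrix_inv_inverse cmat_one)

lemma det_cnj_mat: "det (cnj_mat A) = cnj (det A)"
  by (simp add: det_def)

text \<open>The blocks of \<open>M\<close> are real, so the action commutes with conjugation. The
  difference formula for \<open>Z\<close> and its conjugate, divided by \<open>2 \<i>\<close>, is
  the claim.\<close>

lemma Im_siegel_act:
  assumes M: "M \<in> siegel_group" and Z: "Z \<in> siegel_space"
  shows "cmat (Im_mat (siegel_act M Z)) = transpose (matrix_inv (siegel_factor M Z))
    ** cmat (Im_mat Z) ** cnj_mat (matrix_inv (siegel_factor M Z))"
proof -
  let ?W = "siegel_factor M Z"
  note W = siegel_factor_det_nonzero[OF M Z]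
  have W': "det (siegel_factor M (cnj_mat Z)) \<noteq> 0"
    using W by (simp add: cnj_mat_siegel_factor[symmetric] det_cnj_mat)
  have inv: "matrix_inv (siegel_factor M (cnj_mat Z)) = cnj_mat (matrix_inv ?W)"
    using cnj_mat_matrix_inv[OF W] by (simp add: cnj_mat_siegel_factor)
  have "siegel_act M (cnj_mat Z) = cnj_mat (siegel_act M Z)"
    using inv by (simp add: siegel_act_def siegel_num_def[symmetric] cnj_mat_mult cnj_mat_siegel_num)
  then have "cscale (2 * \<i>) (cmat (Im_mat (siegel_act M Z)))
    = transpose (matrix_inv ?W) ** (Z - cnj_mat Z) ** cnj_mat (matrix_inv ?W)"
    using siegel_act_diff[OF M siegel_spaceD(1)[OF Z] W W'] by (simp add: inv minus_cnj_mat)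
  then have "cscale (2 * \<i>) (cmat (Im_mat (siegel_act M Z))) = cscale (2 * \<i>)
      (transpose (matrix_inv ?W) ** cmat (Im_mat Z) ** cnj_mat (matrix_inv ?W))"
    by (simp add: minus_cnj_mat cscale_matrix_mul_left cscale_matrix_mul_right)
  then show ?thesis by (simp add: vec_eq_iff)
qed

text \<open>The quadratic form of the new imaginary part at a real \<open>x\<close> equals the
  Hermitian form of \<open>Im_mat Z\<close> at \<open>W^-1 x\<close>.\<close>

lemma siegel_act_in_siegel_space:
  assumes M: "M \<in> siegel_group" and Z: "Z \<in> siegel_space"
  shows "siegel_act M Z \<in> siegel_space"
proof -
  let ?W = "siegel_factor M Z" and ?Y' = "Im_mat (siegel_act M Z)"
  note W = siegel_factor_det_nonzero[OF M Z]
  have sym: "transpose (siegel_act M Z) = siegel_act M Z"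
    by (subst siegel_act_transpose_eq[OF M siegel_spaceD(1)[OF Z] W])
      (simp add: matrix_transpose_mul siegel_act_def siegel_num_def)
  then have "transpose ?Y' = ?Y'"
    unfolding Im_mat_def transpose_def vec_eq_iff by simp
  moreover have "x \<bullet> (?Y' *v x) > 0" if x: "x \<noteq> 0" for x
  proof -
    define v where "v = (\<chi> i. complex_of_real (x $ i))"
    have v: "v \<noteq> 0" "cnj_vec v = v" using x by (auto simp: v_def vec_eq_iff)
    let ?u = "matrix_inv ?W *v v"
    have "?u \<noteq> 0"
    proof
      assume "?u = 0"
      then have "?W *v ?u = 0" by simp
      then show False using v by (simp add: matrix_vector_mul_assoc matrix_inv_inverse[OF W])
    qed
    then obtain r where r: "r > 0" "dotc ?u (cmat (Im_mat Z) *v cnj_vec ?u) = of_real r"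
      using dotc_hermitian_pos[OF siegel_spaceD(2)[OF Z]] by blast
    have "of_real (x \<bullet> (?Y' *v x)) = dotc v (cmat ?Y' *v v)"
      by (simp add: inner_vec_def dotc_def matrix_vector_mult_def v_def)
    also have "\<dots> = dotc v (transpose (matrix_inv ?W) *v (cmat (Im_mat Z) *v (cnj_mat (matrix_inv ?W) *v cnj_vec v)))"
      unfolding Im_siegel_act[OF M Z] v(2) by (simp only: matrix_vector_mul_assoc matrix_mul_assoc)
    also have "\<dots> = of_real r"
      unfolding dotc_transpose cnj_mat_mult_cnj_vec r ..
    finally show ?thesis using r(1) by (simp only: of_real_eq_iff)
  qed
  ultimately show ?thesis
    using sym by (simp add: siegel_space_def pos_def_def)
qed

text \<open>Inverting \<open>Im_siegel_act\<close> gives \<open>cnj_mat W\<close> in front of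
  \<open>Y^-1 W^t\<close>. Replacing it by \<open>W - 2 \<i> C Y\<close> leaves a congruence by
  \<open>W\<close> and an anomalous term free of \<open>Y\<close>.\<close>

lemma matrix_inv_Im_siegel_act:
  assumes M: "M \<in> siegel_group" and Z: "Z \<in> siegel_space"
  shows "cmat (matrix_inv (Im_mat (siegel_act M Z)))
    = siegel_factor M Z ** cmat (matrix_inv (Im_mat Z)) ** transpose (siegel_factor M Z)
      - cscale (2 * \<i>) (block_C M ** transpose (siegel_factor M Z))"
proof -
  let ?W = "siegel_factor M Z" and ?Y = "cmat (Im_mat Z)" and ?Yi = "cmat (matrix_inv (Im_mat Z))"
  note W = siegel_factor_det_nonzero[OF M Z]
  have Y: "?Y ** ?Yi = mat 1"
    using matrix_inv_inverse(1)[OF pos_def_det_nonzero[OF siegel_spaceD(2)[OF Z]]]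
    by (simp add: cmat_mult[symmetric] cmat_one)
  have cW: "cnj_mat (matrix_inv ?W) ** cnj_mat ?W = mat 1"
    by (simp add: cnj_mat_mult[symmetric] matrix_inv_inverse[OF W] cnj_mat_one)
  have "cmat (Im_mat (siegel_act M Z)) ** (cnj_mat ?W ** ?Yi ** transpose ?W)
    = transpose (matrix_inv ?W) ** (?Y ** ((cnj_mat (matrix_inv ?W) ** cnj_mat ?W) ** ?Yi)) ** transpose ?W"
    unfolding Im_siegel_act[OF M Z] by (simp only: matrix_mul_assoc)
  also have "\<dots> = mat 1"
    by (simp add: cW Y transpose_matrix_inv_mult[OF W])
  finally have "cmat (matrix_inv (Im_mat (siegel_act M Z))) = cnj_mat ?W ** ?Yi ** transpose ?W"
    using matrix_inv_unique cmat_matrix_inv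
      pos_def_det_nonzero[OF siegel_spaceD(2)[OF siegel_act_in_siegel_space[OF M Z]]] by metis
  also have "cnj_mat ?W = ?W - cscale (2 * \<i>) (block_C M ** ?Y)"
  proof -
    have "?W - cnj_mat ?W = block_C M ** (Z - cnj_mat Z)"
      unfolding cnj_mat_siegel_factor by (simp add: siegel_factor_def matrix_diff_ldistrib)
    then show ?thesis by (simp add: minus_cnj_mat[of Z] cscale_matrix_mul_right algebra_simps)
  qed
  also have "(?W - cscale (2 * \<i>) (block_C M ** ?Y)) ** ?Yi ** transpose ?W
    = ?W ** ?Yi ** transpose ?W - cscale (2 * \<i>) (block_C M ** (?Y ** ?Yi) ** transpose ?W)"
    by (simp only: matrix_diff_rdistrib cscale_matrix_mul_left matrix_mul_assoc)
  finally show ?thesis by (simp add: Y)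
qed

lemma block_C_siegel_factor_symmetric:
  assumes "M \<in> siegel_group" "transpose Z = Z"
  shows "transpose (block_C M ** transpose (siegel_factor M Z)) = block_C M ** transpose (siegel_factor M Z)"
  using siegel_group_blocks(4)[OF assms(1)] assms(2)
  by (simp add: siegel_factor_def transpose_add matrix_transpose_mul matrix_add_ldistrib
      matrix_add_rdistrib matrix_mul_assoc)

section \<open>Partial derivatives on symmetric matrices\<close>

definition sym_part :: "complex ^ 'n ^ 'n \<Rightarrow> complex ^ 'n ^ 'n" where
  "sym_part Z = (\<chi> i j. (Z $ i $ j + Z $ j $ i) / 2)"

lemma sym_part_nth [simp]: "sym_part Z $ i $ j = (Z $ i $ j + Z $ j $ i) / 2"
  by (simp add: sym_part_def)

lemma transpose_nth [simp]: "transpose A $ i $ j = A $ j $ i"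
  by (simp add: transpose_def)

lemma transpose_eq_iff: "transpose A = A \<longleftrightarrow> (\<forall>i j. A $ i $ j = A $ j $ i)"
  by (auto simp: vec_eq_iff)

lemma transpose_sym_part [simp]: "transpose (sym_part Z) = sym_part Z"
  by (simp add: vec_eq_iff add.commute)

lemma sym_part_symmetric: "transpose Z = Z \<Longrightarrow> sym_part Z = Z"
  by (simp add: vec_eq_iff transpose_def)

lemma bounded_linear_sym_part: "bounded_linear sym_part"
proof -
  have "linear (sym_part :: complex ^ 'n ^ 'n \<Rightarrow> _)"
    by (rule linearI) (simp_all add: vec_eq_iff complex_eq_iff field_simps)
  then show ?thesis using linear_conv_bounded_linear by blast
qed

section \<open>Openness of the positivity condition and extension of \<open>f\<close> to an open
  set\<close>

lemma norm_matrix_vector_mult_le: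
  fixes A :: "real ^ 'n ^ 'm"
  shows "norm (A *v x) \<le> norm A * norm x"
proof -
  have "norm (A *v x) = L2_set (\<lambda>i. norm (A $ i \<bullet> x)) UNIV"
    by (simp add: norm_vec_def matrix_vector_mult_def inner_vec_def)
  also have "\<dots> \<le> L2_set (\<lambda>i. norm (A $ i) * norm x) UNIV"
    by (rule L2_set_mono) (auto simp: Cauchy_Schwarz_ineq2)
  also have "\<dots> = norm A * norm x"
    by (simp add: norm_vec_def[of A] L2_set_left_distrib)
  finally show ?thesis .
qed

text \<open>By compactness the form attains its minimum \<open>m > 0\<close> on the unit sphere. A
  perturbation of norm below \<open>m\<close> changes its values there by less than
  \<open>m\<close>.\<close>

lemma open_positive_forms:
  "open {Y :: real ^ 'n ^ 'n. \<forall>x. x \<noteq> 0 \<longrightarrow> x \<bullet> (Y *v x) > 0}"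
proof (rule openI)
  fix Y :: "real ^ 'n ^ 'n" assume "Y \<in> {Y. \<forall>x. x \<noteq> 0 \<longrightarrow> x \<bullet> (Y *v x) > 0}"
  then have Y: "x \<bullet> (Y *v x) > 0" if "x \<noteq> 0" for x using that by simp
  have "\<exists>x0\<in>sphere 0 1. \<forall>x\<in>sphere 0 1. x0 \<bullet> (Y *v x0) \<le> x \<bullet> (Y *v x)"
    by (rule continuous_attains_inf) (auto intro!: continuous_intros simp: matrix_vector_mult_linear_continuous_on)
  then obtain x0 where x0: "norm x0 = 1" "\<And>x. norm x = 1 \<Longrightarrow> x0 \<bullet> (Y *v x0) \<le> x \<bullet> (Y *v x)"
    by auto
  define m where "m = x0 \<bullet> (Y *v x0)"
  have "x0 \<noteq> 0" using x0(1) by auto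
  then have "m > 0" using Y by (simp add: m_def)
  show "\<exists>e>0. ball Y e \<subseteq> {Y. \<forall>x. x \<noteq> 0 \<longrightarrow> x \<bullet> (Y *v x) > 0}"
  proof (intro exI conjI subsetI CollectI allI impI)
    fix Y' and x :: "real ^ 'n" assume Y': "Y' \<in> ball Y m" and x: "x \<noteq> 0"
    define u where "u = x /\<^sub>R norm x"
    have u: "norm u = 1" "x = norm x *\<^sub>R u" using x by (auto simp: u_def)
    have "\<bar>u \<bullet> ((Y - Y') *v u)\<bar> \<le> norm u * norm ((Y - Y') *v u)"
      by (rule Cauchy_Schwarz_ineq2)
    also have "\<dots> < m"
      using norm_matrix_vector_mult_le[of "Y - Y'" u] Y' by (simp add: u dist_norm)
    finally have "u \<bullet> (Y' *v u) > u \<bullet> (Y *v u) - m"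
      by (simp add: matrix_vector_mult_diff_rdistrib inner_diff_right)
    then have "u \<bullet> (Y' *v u) > 0"
      using x0(2)[OF u(1)] by (simp add: m_def)
    then show "x \<bullet> (Y' *v x) > 0"
      using x by (subst (1 2) u(2)) (simp add: matrix_vector_mult_scaleR)
  qed fact
qed

definition siegel_nbhd :: "(complex ^ 'n ^ 'n) set" where
  "siegel_nbhd = {Z. sym_part Z \<in> siegel_space}"

lemma siegel_space_subset_nbhd: "siegel_space \<subseteq> siegel_nbhd"
  by (auto simp: siegel_nbhd_def siegel_space_def sym_part_symmetric)

lemma siegel_nbhd_symmetric:
  "transpose Z = Z \<Longrightarrow> Z \<in> siegel_nbhd \<longleftrightarrow> Z \<in> siegel_space"
  by (simp add: siegel_nbhd_def sym_part_symmetric)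

text \<open>Symmetrization makes the symmetry condition automatic; what remains is the preimage of
  an open condition under a continuous map.\<close>

lemma open_siegel_nbhd: "open (siegel_nbhd :: (complex ^ 'n ^ 'n) set)"
proof -
  have "transpose (Im_mat (sym_part Z)) = Im_mat (sym_part Z)" for Z :: "complex ^ 'n ^ 'n"
    by (simp add: transpose_eq_iff Im_mat_def add.commute)
  then have eq: "siegel_nbhd = (\<lambda>Z :: complex ^ 'n ^ 'n. Im_mat (sym_part Z)) -` {Y. \<forall>x. x \<noteq> 0 \<longrightarrow> x \<bullet> (Y *v x) > 0}"
    by (auto simp: siegel_nbhd_def siegel_space_def pos_def_def)
  have cont: "continuous_on UNIV (\<lambda>Z :: complex ^ 'n ^ 'n. Im_mat (sym_part Z))"
    unfolding Im_mat_def sym_part_def by (intro continuous_intros) auto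
  show ?thesis
    unfolding eq by (rule open_vimage[OF open_positive_forms cont])
qed

text \<open>The given derivative is meaningful in symmetric directions only, so both base point and
  direction are symmetrized. The second property later allows a matrix unit to stand for its
  symmetric part.\<close>

lemma siegel_holomorphic_complex_deriv:
  fixes f :: "complex ^ 'n ^ 'n \<Rightarrow> complex"
  assumes "siegel_holomorphic f"
  obtains D where "complex_deriv_on (\<lambda>Z. f (sym_part Z)) D siegel_nbhd"
    and "\<And>Z V. Z \<in> siegel_nbhd \<Longrightarrow> D Z (sym_part V) = D Z V"
proof -
  obtain E where E: "\<And>Z. Z \<in> siegel_space \<Longrightarrow> (f has_derivative E Z) (at Z within siegel_space)"
      "\<And>Z c V. Z \<in> siegel_space \<Longrightarrow> transpose V = V \<Longrightarrow> E Z (cscale c V) = c * E Z V"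
    using assms unfolding siegel_holomorphic_def cscale_def by metis
  let ?D = "\<lambda>Z V. E (sym_part Z) (sym_part V)"
  show ?thesis
  proof
    show "complex_deriv_on (\<lambda>Z. f (sym_part Z)) ?D siegel_nbhd"
      unfolding complex_deriv_on_def
    proof (intro ballI conjI allI)
      fix Z V :: "complex ^ 'n ^ 'n" and c assume Z: "Z \<in> siegel_nbhd"
      have "(sym_part has_derivative sym_part) (at Z within siegel_nbhd)"
        using bounded_linear_sym_part by (rule bounded_linear_imp_has_derivative)
      moreover have "(f has_derivative E (sym_part Z)) (at (sym_part Z) within sym_part ` siegel_nbhd)"
        using E(1)[of "sym_part Z"] Z by (auto simp: siegel_nbhd_def intro: has_derivative_subset)
      ultimately have "((\<lambda>Z. f (sym_part Z)) has_derivative ?D Z) (at Z within siegel_nbhd)"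
        by (rule has_derivative_in_compose)
      then show "((\<lambda>Z. f (sym_part Z)) has_derivative ?D Z) (at Z)"
        using at_within_open[OF Z open_siegel_nbhd] by simp
      have "sym_part (cscale c V) = cscale c (sym_part V)"
        by (simp add: vec_eq_iff field_simps)
      then show "?D Z (cscale c V) = c * ?D Z V"
        using E(2) Z by (simp add: siegel_nbhd_def)
    qed
    show "?D Z (sym_part V) = ?D Z V" for Z V
      by (simp add: sym_part_symmetric)
  qed
qed

definition matrix_unit :: "'m \<Rightarrow> 'n \<Rightarrow> complex ^ 'n ^ 'm" where
  "matrix_unit i j = (\<chi> a b. if a = i \<and> b = j then 1 else 0)"

text \<open>Varying the coordinate \<open>(i,j)\<close> moves \<open>Z\<close> in the symmetric
  direction \<open>S\<close>, which is twice the symmetric part of the matrix unit off the diagonal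
  and equal to it on the diagonal. The factor \<open>(1 + \<delta>) / 2\<close> compensates exactly
  for this.\<close>

lemma siegel_partial_eq:
  fixes f :: "complex ^ 'n ^ 'n \<Rightarrow> complex"
  assumes D: "complex_deriv_on (\<lambda>Z. f (sym_part Z)) D siegel_nbhd"
    and Ds: "\<And>Z V. Z \<in> siegel_nbhd \<Longrightarrow> D Z (sym_part V) = D Z V"
    and Z: "Z \<in> siegel_space"
  shows "siegel_partial i j f Z = D Z (matrix_unit i j)"
proof -
  have ZU: "Z \<in> siegel_nbhd" using Z siegel_space_subset_nbhd by blast
  define S :: "complex ^ 'n ^ 'n" where "S = (\<chi> a b. if {a, b} = {i, j} then 1 else 0)"
  have sym: "Z $ a $ b = Z $ b $ a" for a b
    using siegel_spaceD(1)[OF Z] by (simp add: transpose_eq_iff)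
  have "(\<chi> a b. if {a, b} = {i, j} then w else Z $ a $ b) = sym_part (Z + cscale (w - Z $ i $ j) S)" for w
  proof -
    have "(\<chi> a b. if {a, b} = {i, j} then w else Z $ a $ b) = Z + cscale (w - Z $ i $ j) S"
      using sym by (auto simp: vec_eq_iff S_def doubleton_eq_iff)
    moreover have "transpose (Z + cscale (w - Z $ i $ j) S) = Z + cscale (w - Z $ i $ j) S"
      using sym by (auto simp: transpose_eq_iff S_def insert_commute)
    ultimately show ?thesis by (simp add: sym_part_symmetric)
  qed
  then have "coord_deriv i j f Z = deriv (\<lambda>w. f (sym_part (Z + cscale (w - Z $ i $ j) S))) (Z $ i $ j)"
    by (simp add: coord_deriv_def)
  also have "\<dots> = D Z S"
  proof (rule DERIV_imp_deriv)
    have "((\<lambda>t. f (sym_part (Z + cscale t S))) has_field_derivative D Z S) (at (Z $ i $ j - Z $ i $ j))"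
      using D ZU has_field_derivative_along_line[of "\<lambda>Z. f (sym_part Z)" "D Z" Z 0 S]
      by (simp add: complex_deriv_on_def)
    moreover have "((\<lambda>w. w - Z $ i $ j) has_field_derivative 1) (at (Z $ i $ j))"
      by (auto intro!: derivative_eq_intros)
    ultimately have "((\<lambda>w. f (sym_part (Z + cscale (w - Z $ i $ j) S))) has_field_derivative D Z S * 1) (at (Z $ i $ j))"
      by (rule DERIV_chain2[where f = "\<lambda>t. f (sym_part (Z + cscale t S))"])
    then show "((\<lambda>w. f (sym_part (Z + cscale (w - Z $ i $ j) S))) has_field_derivative D Z S) (at (Z $ i $ j))"
      by simp
  qed
  finally have "siegel_partial i j f Z = D Z (cscale ((1 + (if i = j then 1 else 0)) / 2) S)"
    using D ZU by (simp add: siegel_partial_def complex_deriv_on_def)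
  also have "cscale ((1 + (if i = j then 1 else 0)) / 2) S = sym_part (matrix_unit i j)"
    by (auto simp: vec_eq_iff S_def matrix_unit_def doubleton_eq_iff)
  also have "D Z (sym_part (matrix_unit i j)) = D Z (matrix_unit i j)"
    by (rule Ds[OF ZU])
  finally show ?thesis .
qed

definition siegel_gradient :: "(complex ^ 'n ^ 'n \<Rightarrow> complex) \<Rightarrow> complex ^ 'n ^ 'n \<Rightarrow> complex ^ 'n ^ 'n" where
  "siegel_gradient f Z = (\<chi> i j. siegel_partial i j f Z)"

lemma transpose_siegel_gradient:
  assumes "transpose Z = Z"
  shows "transpose (siegel_gradient f Z) = siegel_gradient f Z"
  using assms by (simp add: transpose_eq_iff siegel_gradient_def siegel_partial_def coord_deriv_def insert_commute)

lemma matrix_unit_expansion: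
  fixes V :: "complex ^ 'n ^ 'm"
  shows "V = (\<Sum>i\<in>UNIV. \<Sum>j\<in>UNIV. cscale (V $ i $ j) (matrix_unit i j))"
proof -
  have "(\<Sum>i\<in>UNIV. \<Sum>j\<in>UNIV. V $ i $ j * (if a = i \<and> b = j then 1 else 0))
    = (\<Sum>i\<in>UNIV. if a = i then (\<Sum>j\<in>UNIV. if b = j then V $ i $ j else 0) else 0)" for a b
    by (intro sum.cong) (auto simp: if_distrib cong: if_cong)
  then show ?thesis
    by (simp add: vec_eq_iff matrix_unit_def)
qed

text \<open>In trace form, a linear substitution in the direction \<open>V\<close> can be moved onto
  the gradient by cyclicity.\<close>

lemma derivative_eq_trace:
  fixes f :: "complex ^ 'n ^ 'n \<Rightarrow> complex"
  assumes D: "complex_deriv_on (\<lambda>Z. f (sym_part Z)) D siegel_nbhd"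
    and Ds: "\<And>Z V. Z \<in> siegel_nbhd \<Longrightarrow> D Z (sym_part V) = D Z V"
    and Z: "Z \<in> siegel_space"
  shows "D Z V = trace (siegel_gradient f Z ** V)"
proof -
  have ZU: "Z \<in> siegel_nbhd" using Z siegel_space_subset_nbhd by blast
  have lin: "linear (D Z)" using D ZU by (auto simp: complex_deriv_on_def intro: has_derivative_linear)
  have "D Z V = (\<Sum>i\<in>UNIV. \<Sum>j\<in>UNIV. D Z (cscale (V $ i $ j) (matrix_unit i j)))"
    by (subst matrix_unit_expansion) (simp only: linear_sum[OF lin])
  also have "\<dots> = (\<Sum>i\<in>UNIV. \<Sum>j\<in>UNIV. V $ i $ j * siegel_partial i j f Z)"
    using D ZU by (simp add: complex_deriv_on_def siegel_partial_eq[OF D Ds Z])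
  also have "\<dots> = trace (transpose (siegel_gradient f Z) ** V)"
    unfolding trace_def matrix_matrix_mult_def
    by (simp add: siegel_gradient_def mult.commute) (rule sum.swap)
  finally show ?thesis
    by (simp add: transpose_siegel_gradient siegel_spaceD(1)[OF Z])
qed

text \<open>In the Leibniz expansion a permutation other than \<open>id\<close> has at least two
  off-diagonal factors, all vanishing at \<open>0\<close>, so only the diagonal product contributes
  to first order.\<close>

lemma has_field_derivative_det_one_plus:
  "((\<lambda>t. det (mat 1 + cscale t X)) has_field_derivative trace X) (at 0)"
proof -
  let ?I = "\<lambda>i j. if i = j then 1 else 0 :: complex"
  let ?U = "UNIV :: 'a set"
  have 1: "((\<lambda>t. \<Prod>i\<in>?U. ?I i (p i) + t * X $ i $ p i) has_field_derivative
      (\<Sum>i\<in>?U. X $ i $ p i * (\<Prod>j\<in>?U - {i}. ?I j (p j)))) (at 0)" for p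
  proof -
    have "((\<lambda>t. ?I i (p i) + t * X $ i $ p i) has_field_derivative X $ i $ p i) (at 0)" for i
      by (auto intro!: derivative_eq_intros)
    from has_field_derivative_prod[of ?U "\<lambda>i t. ?I i (p i) + t * X $ i $ p i", OF this]
    show ?thesis by simp
  qed
  have "((\<lambda>t. \<Sum>p | p permutes ?U. of_int (sign p) * (\<Prod>i\<in>?U. ?I i (p i) + t * X $ i $ p i))
    has_field_derivative (\<Sum>p | p permutes ?U. of_int (sign p) *
      (\<Sum>i\<in>?U. X $ i $ p i * (\<Prod>j\<in>?U - {i}. ?I j (p j))))) (at 0)"
    by (intro DERIV_sum DERIV_cmult 1)
  moreover have "(\<Sum>i\<in>?U. X $ i $ p i * (\<Prod>j\<in>?U - {i}. ?I j (p j))) = (if p = id then trace X else 0)"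
    if p: "p permutes ?U" for p
  proof (cases "p = id")
    case False
    have zero: "(\<Prod>j\<in>?U - {i}. ?I j (p j)) = 0" for i
    proof -
      \<comment> \<open>a permutation that fixes every index but \<open>i\<close> is the identity\<close>
      have "\<exists>j. j \<noteq> i \<and> p j \<noteq> j"
      proof (rule ccontr)
        assume *: "\<nexists>j. j \<noteq> i \<and> p j \<noteq> j"
        then have "p i = i" using permutes_inj[OF p] by (metis injD)
        with * False show False by (metis eq_id_iff)
      qed
      then obtain j where "j \<noteq> i" "p j \<noteq> j" by blast
      then show ?thesis by (intro prod_zero bexI[of _ j]) auto
    qed
    show ?thesis unfolding zero using False by simp
  qed (simp add: trace_def)
  ultimately show ?thesis
    by (simp add: det_def mat_def sign_id if_distrib permutes_id sum.delta finite_permutations cong: if_cong)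
qed

text \<open>The conjugate of \<open>M\<close> is itself an admissible \<open>V\<close>, and pairing
  with it gives the sum of the squared absolute values of the entries.\<close>

lemma trace_symmetric_eq_0:
  fixes M :: "complex ^ 'n ^ 'n"
  assumes "transpose M = M" and "\<And>V. transpose V = V \<Longrightarrow> trace (M ** V) = 0"
  shows "M = 0"
proof -
  have sym: "M $ i $ j = M $ j $ i" for i j using assms(1) by (simp add: transpose_eq_iff)
  have "transpose (cnj_mat M) = cnj_mat M" using sym by (simp add: transpose_eq_iff)
  then have "0 = Re (trace (M ** cnj_mat M))" using assms(2) by simp
  also have "\<dots> = (\<Sum>i\<in>UNIV. \<Sum>j\<in>UNIV. Re (M $ i $ j * cnj (M $ j $ i)))"
    by (simp only: trace_def matrix_matrix_mult_def Re_sum vec_lambda_beta cnj_mat_nth)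
  also have "\<dots> = (\<Sum>i\<in>UNIV. \<Sum>j\<in>UNIV. (cmod (M $ i $ j))\<^sup>2)"
  proof (intro sum.cong refl)
    fix i j
    show "Re (M $ i $ j * cnj (M $ j $ i)) = (cmod (M $ i $ j))\<^sup>2"
      unfolding sym[of j i] by (simp only: cmod_power2) (simp add: power2_eq_square)
  qed
  finally show ?thesis
    by (simp add: vec_eq_iff sum_nonneg_eq_0_iff sum_nonneg)
qed

section \<open>Transformation of the matrix of partial derivatives\<close>

lemma norm_cscale: "norm (cscale c V) = norm c * norm V"
  by (simp add: norm_vec_def norm_mult L2_set_right_distrib)

text \<open>Caratheodory's form of differentiability: a difference quotient \<open>Q\<close>
  continuous at \<open>0\<close> has the derivative as its value there.\<close>

lemma has_derivative_cscale_difference: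
  assumes eq: "\<forall>\<^sub>F t in at 0. \<phi> t - \<phi> 0 = cscale t (Q t)" and Q: "isCont Q 0"
  shows "(\<phi> has_derivative (\<lambda>t. cscale t (Q 0))) (at 0)"
  unfolding has_derivative_at
proof (intro conjI bounded_linear_cscale_left)
  have "((\<lambda>t. norm (Q t - Q 0)) \<longlongrightarrow> 0) (at 0)"
    using Q by (simp add: isCont_def LIM_zero tendsto_norm_zero)
  moreover have "\<forall>\<^sub>F t in at 0. norm (Q t - Q 0)
      = norm (\<phi> (0 + t) - \<phi> 0 - cscale t (Q 0)) / norm t"
    using eq eventually_neq_at_within[of 0]
    by eventually_elim (simp add: norm_cscale flip: cscale_diff_right)
  ultimately show "(\<lambda>t. norm (\<phi> (0 + t) - \<phi> 0 - cscale t (Q 0)) / norm t) \<midarrow>0\<rightarrow> 0"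
    by (rule Lim_transform_eventually)
qed

lemma siegel_factor_line:
  "siegel_factor M (Z + cscale t V) = siegel_factor M Z + cscale t (block_C M ** V)"
  by (simp add: siegel_factor_def matrix_add_ldistrib cscale_matrix_mul_right)

text \<open>A symmetric direction keeps the line inside the symmetric matrices, where the open set
  \<open>siegel_nbhd\<close> coincides with the Siegel space.\<close>

lemma siegel_space_line:
  assumes Z: "Z \<in> siegel_space" and V: "transpose V = V"
  obtains r where "r > 0" "\<And>t. norm t \<le> r \<Longrightarrow> Z + cscale t V \<in> siegel_space"
proof -
  obtain e r where "e > 0" "r > 0" and er: "\<And>Z' t. Z' \<in> ball Z e \<Longrightarrow> norm t \<le> r \<Longrightarrow> Z' + cscale t V \<in> siegel_nbhd"
    using open_line_segment_nbhd[OF open_siegel_nbhd] siegel_space_subset_nbhd Z by blast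
  have "transpose (Z + cscale t V) = Z + cscale t V" for t
    by (simp add: transpose_add transpose_cscale V siegel_spaceD(1)[OF Z])
  then show ?thesis
    using that[OF \<open>r > 0\<close>] er[of Z] \<open>e > 0\<close> by (simp add: siegel_nbhd_symmetric)
qed

text \<open>By \<open>siegel_act_diff\<close> the difference quotient is \<open>Q t\<close>, with
  one inverse taken at the moving point and the other at \<open>Z\<close>; it remains to see that
  \<open>Q\<close> is continuous.\<close>

lemma has_derivative_siegel_act_line:
  assumes M: "M \<in> siegel_group" and Z: "Z \<in> siegel_space" and V: "transpose V = V"
  shows "((\<lambda>t. siegel_act M (Z + cscale t V)) has_derivative
    (\<lambda>t. cscale t (transpose (matrix_inv (siegel_factor M Z)) ** V ** matrix_inv (siegel_factor M Z)))) (at 0)"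
proof -
  obtain r where r: "r > 0" "\<And>t. norm t \<le> r \<Longrightarrow> Z + cscale t V \<in> siegel_space"
    using siegel_space_line[OF Z V] by blast
  let ?Wi = "\<lambda>t. matrix_inv (siegel_factor M (Z + cscale t V))"
  define Q where "Q t = transpose (?Wi t) ** V ** ?Wi 0" for t
  have W: "det (siegel_factor M (Z + cscale t V)) \<noteq> 0" if "norm t \<le> r" for t
    using siegel_factor_det_nonzero[OF M r(2)[OF that]] .
  have "siegel_act M (Z + cscale t V) - siegel_act M (Z + cscale 0 V) = cscale t (Q t)" if "norm t \<le> r" for t
    using siegel_act_diff[OF M siegel_spaceD(1)[OF r(2)[OF that]] W[OF that] W[of 0]] r(1)
    by (simp add: Q_def cscale_matrix_mul_left cscale_matrix_mul_right)
  then have eq: "\<forall>\<^sub>F t in at 0. siegel_act M (Z + cscale t V) - siegel_act M (Z + cscale 0 V) = cscale t (Q t)"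
    using r(1) by (auto simp: eventually_at intro!: exI[of _ r])
  \<comment> \<open>Continuity of the inverse is the order \<open>0\<close> case of
    \<open>Cn_on_matrix_inv\<close>.\<close>
  have cont: "continuous_on (ball 0 r) (\<lambda>t. ?Wi t $ i $ j)" for i j
  proof -
    have "Cn_on 0 (\<lambda>t. siegel_factor M (Z + cscale t V) $ i $ j) (ball 0 r)" for i j
      unfolding siegel_factor_line Cn_on.simps by simp (intro continuous_intros)
    from Cn_on_matrix_inv[OF this] show ?thesis using W by simp
  qed
  have "continuous_on (ball 0 r) Q"
    unfolding Q_def matrix_matrix_mult_def transpose_def vec_lambda_beta
    by (intro continuous_on_vec_lambda continuous_on_sum continuous_on_mult continuous_on_const cont)
  then have "isCont Q 0" using r(1) by (simp add: continuous_on_eq_continuous_at)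
  from has_derivative_cscale_difference[OF eq this] show ?thesis by (simp add: Q_def)
qed

text \<open>Factoring out \<open>W\<close> from \<open>W + t C V\<close> reduces the claim to the
  determinant of \<open>1 + t X\<close> with \<open>X = W^-1 C V\<close>.\<close>

lemma DERIV_det_siegel_factor_line:
  assumes W: "det (siegel_factor M Z) \<noteq> 0"
  shows "((\<lambda>t. det (siegel_factor M (Z + cscale t V))) has_field_derivative
    det (siegel_factor M Z) * trace (matrix_inv (siegel_factor M Z) ** block_C M ** V)) (at 0)"
proof -
  let ?W = "siegel_factor M Z"
  let ?X = "matrix_inv ?W ** block_C M ** V"
  have "det (siegel_factor M (Z + cscale t V)) = det ?W * det (mat 1 + cscale t ?X)" for t
  proof -
    have "?W ** (mat 1 + cscale t ?X) = ?W + cscale t ((?W ** matrix_inv ?W) ** block_C M ** V)"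
      by (simp only: matrix_add_ldistrib cscale_matrix_mul_right matrix_mul_assoc matrix_mul_rid)
    then show ?thesis
      by (simp add: siegel_factor_line matrix_inv_inverse[OF W] flip: det_mul)
  qed
  then show ?thesis
    by (simp add: DERIV_cmult has_field_derivative_det_one_plus)
qed

text \<open>Both sides of \<open>f (\<gamma> Z) = (det W)^m f Z\<close> are differentiated along
  every symmetric \<open>V\<close>. Each derivative is the trace of a symmetric matrix times
  \<open>V\<close>, so the matrices themselves agree.\<close>

lemma siegel_gradient_transform:
  fixes f :: "complex ^ 'n ^ 'n \<Rightarrow> complex"
  assumes hol: "siegel_holomorphic f" and mod: "modular_of_weight m f"
    and M: "M \<in> siegel_group" and Z: "Z \<in> siegel_space"
  shows "siegel_gradient f (siegel_act M Z) = cscale (det (siegel_factor M Z) ^ m)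
    (siegel_factor M Z ** siegel_gradient f Z ** transpose (siegel_factor M Z)
      + cscale (of_nat m * f Z) (block_C M ** transpose (siegel_factor M Z)))"
proof -
  let ?W = "siegel_factor M Z" and ?C = "block_C M" and ?Z' = "siegel_act M Z"
  let ?Wi = "matrix_inv ?W" and ?P = "siegel_gradient f Z" and ?P' = "siegel_gradient f ?Z'"
  let ?d = "det ?W ^ m"
  obtain D where D: "complex_deriv_on (\<lambda>Z. f (sym_part Z)) D siegel_nbhd"
    and Ds: "\<And>Z V. Z \<in> siegel_nbhd \<Longrightarrow> D Z (sym_part V) = D Z V"
    using siegel_holomorphic_complex_deriv[OF hol] by blast
  note W = siegel_factor_det_nonzero[OF M Z]
  note Z' = siegel_act_in_siegel_space[OF M Z]
  have nb: "Z \<in> siegel_nbhd" "?Z' \<in> siegel_nbhd" using Z Z' siegel_space_subset_nbhd by auto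
  \<comment> \<open>\<open>W^-1 C\<close> is congruent to \<open>C W^t\<close>, hence
    symmetric.\<close>
  have sC: "transpose (?Wi ** ?C) = ?Wi ** ?C"
  proof -
    have "?Wi ** ?C = ?Wi ** (?C ** transpose ?W) ** transpose ?Wi"
      by (simp add: matrix_mul_assoc[symmetric] transpose_matrix_inv_mult[OF W])
    moreover have "transpose (?Wi ** (?C ** transpose ?W) ** transpose ?Wi)
        = ?Wi ** (?C ** transpose ?W) ** transpose ?Wi"
      using block_C_siegel_factor_symmetric[OF M siegel_spaceD(1)[OF Z]]
      by (metis matrix_mul_assoc matrix_transpose_mul transpose_transpose)
    ultimately show ?thesis by simp
  qed
  \<comment> \<open>The difference of the two sides of the claim, multiplied by \<open>W^-1\<close>
    on the left and by \<open>W^-t\<close> on the right, so that it pairs with \<open>V\<close>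
    itself.\<close>
  define N where "N = ?Wi ** ?P' ** transpose ?Wi - cscale ?d (?P + cscale (of_nat m * f Z) (?Wi ** ?C))"
  have "N = 0"
  proof (rule trace_symmetric_eq_0)
    have "transpose (?Wi ** ?P' ** transpose ?Wi) = ?Wi ** ?P' ** transpose ?Wi"
      by (simp add: matrix_transpose_mul transpose_siegel_gradient siegel_spaceD(1)[OF Z'] matrix_mul_assoc)
    then show "transpose N = N"
      by (simp add: N_def transpose_diff transpose_add transpose_cscale sC
          transpose_siegel_gradient siegel_spaceD(1)[OF Z])
  next
    fix V :: "complex ^ 'n ^ 'n" assume V: "transpose V = V"
    obtain r where r: "r > 0" "\<And>t. norm t \<le> r \<Longrightarrow> Z + cscale t V \<in> siegel_space"
      using siegel_space_line[OF Z V] by blast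
    have sp: "sym_part X = X" if "X \<in> siegel_space" for X
      using that by (simp add: sym_part_symmetric siegel_spaceD(1))
    have fd: "((\<lambda>Z. f (sym_part Z)) has_derivative D X) (at X)" if "X \<in> siegel_nbhd" for X
      using D that by (simp add: complex_deriv_on_def)
    have Dl: "D X (cscale c V) = c * D X V" if "X \<in> siegel_nbhd" for X c V
      using D that by (simp add: complex_deriv_on_def)
    have lhs: "((\<lambda>t. f (sym_part (siegel_act M (Z + cscale t V)))) has_field_derivative
        D ?Z' (transpose ?Wi ** V ** ?Wi)) (at 0)"
      using has_derivative_compose[OF has_derivative_siegel_act_line[OF M Z V], of "\<lambda>Z. f (sym_part Z)" "D ?Z'"]
      by (simp add: fd nb Dl has_field_derivative_def mult_commute_abs mult.commute[of _ "D _ _"])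
    \<comment> \<open>The power rule has exponent \<open>m - 1\<close>; one factor from the
      derivative of the determinant restores \<open>m\<close>. For \<open>m = 0\<close> both sides
      vanish.\<close>
    have pow: "((\<lambda>t. det (siegel_factor M (Z + cscale t V)) ^ m) has_field_derivative
        of_nat m * trace (?Wi ** ?C ** V) * ?d) (at 0)"
      using DERIV_power[OF DERIV_det_siegel_factor_line[OF W, of V], of m]
      by (cases m) (simp_all add: algebra_simps)
    have "((\<lambda>t. f (sym_part (Z + cscale t V))) has_field_derivative D Z V) (at 0)"
      by (rule has_field_derivative_along_line) (simp_all add: fd nb Dl)
    from DERIV_mult[OF pow this]
    have prod: "((\<lambda>t. det (siegel_factor M (Z + cscale t V)) ^ m * f (sym_part (Z + cscale t V)))
        has_field_derivative ?d * (D Z V + of_nat m * f Z * trace (?Wi ** ?C ** V))) (at 0)"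
      by (simp add: sp[OF Z] algebra_simps)
    have eq: "det (siegel_factor M (Z + cscale t V)) ^ m * f (sym_part (Z + cscale t V))
        = f (sym_part (siegel_act M (Z + cscale t V)))" if "t \<in> ball 0 r" for t
    proof -
      have "Z + cscale t V \<in> siegel_space" using that r by simp
      then show ?thesis
        using mod M siegel_act_in_siegel_space[OF M] by (simp add: sp modular_of_weight_def)
    qed
    have "((\<lambda>t. f (sym_part (siegel_act M (Z + cscale t V)))) has_field_derivative
        ?d * (D Z V + of_nat m * f Z * trace (?Wi ** ?C ** V))) (at 0)"
      by (rule has_field_derivative_transform_within_open[OF prod open_ball[of 0 r] _ eq]) (use r in auto)
    with lhs have "D ?Z' (transpose ?Wi ** V ** ?Wi) = ?d * (D Z V + of_nat m * f Z * trace (?Wi ** ?C ** V))"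
      by (rule DERIV_unique)
    then have "trace (?P' ** (transpose ?Wi ** V ** ?Wi)) = ?d * (trace (?P ** V) + of_nat m * f Z * trace (?Wi ** ?C ** V))"
      by (simp add: derivative_eq_trace[OF D Ds] Z Z')
    moreover have "trace (?P' ** (transpose ?Wi ** V ** ?Wi)) = trace (?Wi ** ?P' ** transpose ?Wi ** V)"
      using trace_mul_sym[of "?P' ** transpose ?Wi ** V" ?Wi] by (simp add: matrix_mul_assoc)
    moreover have tr: "trace (cscale c X) = c * trace X" for c and X :: "complex ^ 'n ^ 'n"
      by (simp add: trace_def sum_distrib_left)
    ultimately show "trace (N ** V) = 0"
      by (simp add: N_def matrix_diff_rdistrib matrix_add_rdistrib cscale_matrix_mul_left trace_sub trace_add)
  qed
  then have "?W ** (?Wi ** ?P' ** transpose ?Wi) ** transpose ?W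
    = ?W ** cscale ?d (?P + cscale (of_nat m * f Z) (?Wi ** ?C)) ** transpose ?W"
    by (simp add: N_def)
  moreover have "?W ** (?Wi ** ?P' ** transpose ?Wi) ** transpose ?W
    = (?W ** ?Wi) ** ?P' ** (transpose ?Wi ** transpose ?W)"
    by (simp only: matrix_mul_assoc)
  moreover have "?W ** cscale ?d (?P + cscale (of_nat m * f Z) (?Wi ** ?C)) ** transpose ?W
    = cscale ?d (?W ** ?P ** transpose ?W + cscale (of_nat m * f Z) ((?W ** ?Wi) ** ?C ** transpose ?W))"
    by (simp only: matrix_add_ldistrib matrix_add_rdistrib cscale_matrix_mul_left cscale_matrix_mul_right matrix_mul_assoc)
  ultimately show ?thesis
    by (simp add: matrix_inv_inverse[OF W] transpose_matrix_inv_mult[OF W])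
qed

theorem theorem2p7:
  fixes k :: nat and f :: "complex ^ 'n ^ 'n \<Rightarrow> complex"
  assumes "k \<ge> 1"
    and "f \<in> siegel_modular_forms (2 * k)"
  shows "(\<lambda>Z. det (\<chi> i j. siegel_partial i j f Z
             - \<i> * of_nat k * of_real (matrix_inv (Im_mat Z) $ i $ j) * f Z))
         \<in> smooth_siegel_modular_forms (2 * k * CARD('n) + 2)"
proof -
  have hol: "siegel_holomorphic f" and mod: "modular_of_weight (2 * k) f"
    using assms(2) by (auto simp: siegel_modular_forms_def)
  obtain D where D: "complex_deriv_on (\<lambda>Z. f (sym_part Z)) D siegel_nbhd"
    and Ds: "\<And>Z V. Z \<in> siegel_nbhd \<Longrightarrow> D Z (sym_part V) = D Z V"
    using siegel_holomorphic_complex_deriv[OF hol] by blast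
  \<comment> \<open>On symmetric matrices \<open>f\<close> agrees with its symmetrized extension,
    which is holomorphic on an open set.\<close>
  have smooth_f: "Cn_on n f siegel_space" for n
    by (rule Cn_on_cong[OF Cn_on_subset[OF complex_deriv_on_imp_Cn_on[OF open_siegel_nbhd D] siegel_space_subset_nbhd]])
      (simp add: sym_part_symmetric siegel_spaceD)
  have smooth_partial: "Cn_on n (\<lambda>Z. siegel_partial i j f Z) siegel_space" for n i j
  proof -
    have "Cn_on n (\<lambda>Z. D Z (matrix_unit i j)) siegel_nbhd"
      using complex_deriv_on_directional_differentiable[OF open_siegel_nbhd D]
        complex_deriv_on_imp_Cn_on[OF open_siegel_nbhd] by blast
    from Cn_on_subset[OF this siegel_space_subset_nbhd] show ?thesis
      by (rule Cn_on_cong) (simp add: siegel_partial_eq[OF D Ds])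
  qed
  \<comment> \<open>The inverse of \<open>Y\<close> is only real-smooth in \<open>Z\<close>: the
    entries of \<open>Y\<close> are real linear and \<open>det Y\<close> does not vanish.\<close>
  have smooth_inv: "Cn_on n (\<lambda>Z :: complex ^ 'n ^ 'n. matrix_inv (Im_mat Z) $ i $ j) siegel_space" for n i j
  proof (rule Cn_on_matrix_inv)
    have "bounded_linear (\<lambda>Z :: complex ^ 'n ^ 'n. Im (Z $ i $ j))" for i j
      by (intro bounded_linear_compose[OF bounded_linear_Im]
          bounded_linear_compose[OF bounded_linear_vec_nth bounded_linear_vec_nth])
    from Cn_on_bounded_linear[OF this Cn_on_ident]
    show "Cn_on n (\<lambda>Z :: complex ^ 'n ^ 'n. Im_mat Z $ i $ j) siegel_space" for i j
      by (simp add: Im_mat_def)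
  qed (simp add: pos_def_det_nonzero siegel_spaceD)
  let ?N = "\<lambda>Z. siegel_gradient f Z - cscale (\<i> * of_nat k * f Z) (cmat (matrix_inv (Im_mat Z)))"
  have N: "(\<chi> i j. siegel_partial i j f Z
             - \<i> * of_nat k * of_real (matrix_inv (Im_mat Z) $ i $ j) * f Z) = ?N Z" for Z
    by (simp add: vec_eq_iff siegel_gradient_def)
  have "Cn_on n (\<lambda>Z. det (?N Z)) siegel_space" for n
    unfolding N[symmetric]
    by (rule Cn_on_det) (simp, intro Cn_on_diff Cn_on_mult Cn_on_const smooth_f smooth_partial
        Cn_on_bounded_linear[OF bounded_linear_of_real] smooth_inv)
  moreover have "modular_of_weight (2 * k * CARD('n) + 2) (\<lambda>Z. det (?N Z))"
    unfolding modular_of_weight_def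
  proof (intro ballI)
    fix M :: "int ^ ('n + 'n) ^ ('n + 'n)" and Z :: "complex ^ 'n ^ 'n"
    assume M: "M \<in> siegel_group" and Z: "Z \<in> siegel_space"
    let ?W = "siegel_factor M Z"
    have fZ: "f (siegel_act M Z) = det ?W ^ (2 * k) * f Z"
      using mod M Z by (simp add: modular_of_weight_def)
    \<comment> \<open>The gradient contributes \<open>2 k f C W^t\<close>, and
      \<open>- \<i> k f\<close> times \<open>- 2 \<i> C W^t\<close> contributes
      \<open>- 2 k f C W^t\<close>, both scaled by \<open>(det W)^(2 k)\<close>. They cancel,
      leaving a congruence by \<open>W\<close>.\<close>
    have "?N (siegel_act M Z) = cscale (det ?W ^ (2 * k)) (?W ** ?N Z ** transpose ?W)"
      unfolding siegel_gradient_transform[OF hol mod M Z] matrix_inv_Im_siegel_act[OF M Z] fZ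
        matrix_diff_ldistrib matrix_diff_rdistrib cscale_matrix_mul_left cscale_matrix_mul_right
      by (simp add: vec_eq_iff algebra_simps)
    \<comment> \<open>The scalar enters the determinant once per row, giving the exponent
      \<open>2 k g\<close>; \<open>W\<close> and its transpose add \<open>2\<close>.\<close>
    then show "det (?N (siegel_act M Z)) = det ?W ^ (2 * k * CARD('n) + 2) * det (?N Z)"
      by (simp add: det_cscale det_mul power_mult[symmetric] power_add power2_eq_square)
  qed
  ultimately show ?thesis
    unfolding N by (simp add: smooth_siegel_modular_forms_def Cinf_on_def)
qed

end
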